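(* Let $\mathcal{P}=\langle X \mid L_1=R_1,\ldots,L_n=R_n\rangle$ be a semigroup presentation (with $X$ finite) which satisfies condition $K_3^2$ and such that each defining relation $L=R$ of $\mathcal{P}$ satisfies $\|L\|+\|R\|\geq 7$. Then the semigroup presented by $\mathcal{P}$ is automatic.
   Context: Words. $X^+$ (resp. $X^*$) is the set of non-empty (resp. all) words over $X$; $\varepsilon$ is the empty word. All semigroups are taken with an identity $1$ (i.e. they are monoids), and $\varepsilon$ represents $1$; thus the semigroup presented by $\mathcal{P}$ is the monoid generated by $X$ subject to the relations $L_i=R_i$, where $L_i,R_i\in X^+$. Pieces. The relations $L_i=R_i$ are the defining relations; the set of defining words is $\mathcal{R}=\{L_1,\ldots,L_n\}\cup\{R_1,\ldots,R_n\}$. A piece is a word $P$ such that there are defining words $W_1,W_2$ (possibly equal) with decompositions $W_1=U_1PU_2$, $W_2=V_1PV_2$ and either $U_1\neq V_1$ or $U_2\neq V_2$. For $W\in X^*$ the piece-length $\|W\|$ is the minimal $k$ such that $W=P_1\cdots P_k$ with all $P_i$ pieces ($\|\varepsilon\|=0$, and $\|W\|=\infty$ if there is no such decomposition). Condition $K_3^2$: (a) for each defining relation $L=R$, the words $L$ and $R$ start with different generators and end with different generators; (b) each defining word $W$ has $\|W\|\geq 3$; (c) if $R_1=L_1$ and $R_2=L_2$ are two defining relations then the four words $R_1,L_1,R_2,L_2$ are distinct. Automaticity. Let $\$\notin X$ and $X(2,\$)=((X\cup\{\$\})\times(X\cup\{\$\}))\setminus\{(\$,\$)\}$. For $W=x_1\cdots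 x_n$, $U=y_1\cdots y_m$ in $X^*$, $(W,U)\delta_X\in X(2,\$)^*$ is the word of pairs $(x_1,y_1)(x_2,y_2)\cdots$ obtained after padding the shorter of the two words on the right with $\$$'s to the length of the longer. A finitely generated semigroup $S$ is automatic if there are a finite generating set $X$ and a regular language $L\subseteq X^*$ such that (1) $L$ maps onto $S$ under the natural map $W\mapsto\overline{W}$; (2) for every $x\in X\cup\{\varepsilon\}$ the set $L_x=\{(W,U)\delta_X : W,U\in L,\ \overline{Wx}=\overline{U}\}$ is regular. Such an $L$ is called an automatic structure. *)

theory Defs
  imports "HOL-Algebra.Group" "HOL-Library.Extended_Nat"
begin

type_synonym 'a word = "'a list"

section \<open>Presentations and the monoids they define\<close>

text \<open>A presentation consists of a finite alphabet \<open>X\<close> and a finite set \<open>E\<close> of pairs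
  \<open>(L, R)\<close>, one for each defining relation \<open>L = R\<close>, where \<open>L\<close> and \<open>R\<close> are non-empty words.\<close>

definition finite_presentation :: "'a set \<Rightarrow> ('a word \<times> 'a word) set \<Rightarrow> bool" where
  "finite_presentation X E \<longleftrightarrow>
     finite X \<and> finite E \<and> (\<forall>(L, R)\<in>E. L \<in> lists X - {[]} \<and> R \<in> lists X - {[]})"

inductive_set pres_cong :: "'a set \<Rightarrow> ('a word \<times> 'a word) set \<Rightarrow> ('a word \<times> 'a word) set"
  for X E where
  base: "(L, R) \<in> E \<Longrightarrow> (L, R) \<in> pres_cong X E"
| refl: "w \<in> lists X \<Longrightarrow> (w, w) \<in> pres_cong X E"
| sym: "(u, v) \<in> pres_cong X E \<Longrightarrow> (v, u) \<in> pres_cong X E"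
| trans: "(u, v) \<in> pres_cong X E \<Longrightarrow> (v, w) \<in> pres_cong X E \<Longrightarrow> (u, w) \<in> pres_cong X E"
| append: "(u, v) \<in> pres_cong X E \<Longrightarrow> (u', v') \<in> pres_cong X E \<Longrightarrow> (u @ u', v @ v') \<in> pres_cong X E"

text \<open>Semigroups are taken with an identity: the object presented is the monoid
  \<open>X\<^sup>*\<close> modulo the least congruence containing \<open>E\<close>, and the empty word represents the identity.\<close>

definition presented_monoid :: "'a set \<Rightarrow> ('a word \<times> 'a word) set \<Rightarrow> 'a word set monoid" where
  "presented_monoid X E =
     \<lparr>carrier = lists X // pres_cong X E,
      mult = (\<lambda>A B. \<Union>a\<in>A. \<Union>b\<in>B. pres_cong X E `` {a @ b}),
      one = pres_cong X E `` {[]}\<rparr>"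

lemma equiv_pres_cong:
  assumes "finite_presentation X E"
  shows "equiv (lists X) (pres_cong X E)"
proof (rule equivI)
  have "u \<in> lists X \<and> v \<in> lists X" if "(u, v) \<in> pres_cong X E" for u v
    using that assms by induction (auto simp: finite_presentation_def)
  then show "pres_cong X E \<subseteq> lists X \<times> lists X" by (metis mem_Sigma_iff subrelI)
  show "refl_on (lists X) (pres_cong X E)"
    by (auto simp: refl_on_def intro: pres_cong.refl)
  show "sym (pres_cong X E)" by (auto simp: sym_def intro: pres_cong.sym)
  show "trans (pres_cong X E)" by (auto simp: trans_def intro: pres_cong.trans)
qed

lemma presented_monoid_mult:
  assumes "finite_presentation X E" and "u \<in> lists X" and "v \<in> lists X"
  shows "pres_cong X E `` {u} \<otimes>\<^bsub>presented_monoid X E\<^esub> pres_cong X E `` {v} = pres_cong X E `` {u @ v}"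
proof -
  let ?C = "pres_cong X E"
  note eq = equiv_pres_cong[OF assms(1)]
  have "congruent2 ?C ?C (\<lambda>a b. ?C `` {a @ b})"
    by (auto simp: congruent2_def intro!: equiv_class_eq[OF eq] pres_cong.append)
  from UN_equiv_class2[OF eq eq this assms(2,3)] show ?thesis
    by (simp add: presented_monoid_def)
qed

lemma monoid_presented_monoid:
  assumes "finite_presentation X E"
  shows "monoid (presented_monoid X E)"
proof -
  let ?S = "presented_monoid X E" and ?C = "pres_cong X E"
  note m = presented_monoid_mult[OF assms]
  have car: "carrier ?S = (\<lambda>u. ?C `` {u}) ` lists X"
    by (auto simp: presented_monoid_def quotient_def)
  have one: "\<one>\<^bsub>?S\<^esub> = ?C `` {[]}" by (simp add: presented_monoid_def)
  show ?thesis
  proof (rule monoidI)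
    fix x y z assume "x \<in> carrier ?S" "y \<in> carrier ?S" "z \<in> carrier ?S"
    then obtain u v w where "u \<in> lists X" "x = ?C `` {u}" "v \<in> lists X" "y = ?C `` {v}"
      "w \<in> lists X" "z = ?C `` {w}"
      unfolding car by blast
    then show "x \<otimes>\<^bsub>?S\<^esub> y \<otimes>\<^bsub>?S\<^esub> z = x \<otimes>\<^bsub>?S\<^esub> (y \<otimes>\<^bsub>?S\<^esub> z)"
      by (simp only: m append_in_lists_conv simp_thms append_assoc)
  next
    fix x y assume "x \<in> carrier ?S" "y \<in> carrier ?S"
    then show "x \<otimes>\<^bsub>?S\<^esub> y \<in> carrier ?S"
      unfolding car using m append_in_lists_conv by (smt (verit) image_iff)
  next
    show "\<one>\<^bsub>?S\<^esub> \<in> carrier ?S"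
      unfolding car one by blast
  next
    fix x assume "x \<in> carrier ?S"
    then obtain u where u: "u \<in> lists X" "x = ?C `` {u}"
      unfolding car by blast
    show "\<one>\<^bsub>?S\<^esub> \<otimes>\<^bsub>?S\<^esub> x = x"
      using m[OF lists.Nil u(1)] by (simp only: one u(2) append_Nil)
    show "x \<otimes>\<^bsub>?S\<^esub> \<one>\<^bsub>?S\<^esub> = x"
      using m[OF u(1) lists.Nil] by (simp only: one u(2) append_Nil2)
  qed
qed

section \<open>Pieces and the small overlap condition\<close>

definition defining_words :: "('a word \<times> 'a word) set \<Rightarrow> 'a word set" where
  "defining_words E = fst ` E \<union> snd ` E"

definition piece :: "('a word \<times> 'a word) set \<Rightarrow> 'a word \<Rightarrow> bool" where
  "piece E P \<longleftrightarrow>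
     (\<exists>W1\<in>defining_words E. \<exists>W2\<in>defining_words E. \<exists>U1 U2 V1 V2.
        W1 = U1 @ P @ U2 \<and> W2 = V1 @ P @ V2 \<and> (U1 \<noteq> V1 \<or> U2 \<noteq> V2))"

text \<open>The infimum of the empty set is \<open>\<infinity>\<close>, and the empty word is the product of zero pieces.\<close>

definition piece_length :: "('a word \<times> 'a word) set \<Rightarrow> 'a word \<Rightarrow> enat" where
  "piece_length E W = Inf {enat (length Ps) |Ps. (\<forall>P\<in>set Ps. piece E P) \<and> W = concat Ps}"

definition K32 :: "('a word \<times> 'a word) set \<Rightarrow> bool" where
  "K32 E \<longleftrightarrow>
     (\<forall>(L, R)\<in>E. hd L \<noteq> hd R \<and> last L \<noteq> last R) \<and>
     (\<forall>W\<in>defining_words E. piece_length E W \<ge> 3) \<and>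
     (\<forall>(L1, R1)\<in>E. \<forall>(L2, R2)\<in>E. (L1, R1) \<noteq> (L2, R2) \<longrightarrow> distinct [R1, L1, R2, L2])"

section \<open>Regular languages\<close>

text \<open>Languages over the finite alphabet \<open>A\<close> accepted by a complete deterministic finite
  automaton with state set \<open>Q\<close>; taking states to be natural numbers is no restriction.\<close>

definition regular_language :: "'a set \<Rightarrow> 'a word set \<Rightarrow> bool" where
  "regular_language A L \<longleftrightarrow> finite A \<and>
     (\<exists>(Q :: nat set) q0 F (\<delta> :: nat \<Rightarrow> 'a \<Rightarrow> nat).
        finite Q \<and> q0 \<in> Q \<and> F \<subseteq> Q \<and> (\<forall>q\<in>Q. \<forall>a\<in>A. \<delta> q a \<in> Q) \<and>
        L = {w \<in> lists A. foldl \<delta> q0 w \<in> F})"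

section \<open>Automatic monoids\<close>

text \<open>The padding symbol is \<open>None\<close>.\<close>

definition padded_alphabet :: "'a set \<Rightarrow> ('a option \<times> 'a option) set" where
  "padded_alphabet X =
     (insert None (Some ` X)) \<times> (insert None (Some ` X)) - {(None, None)}"

definition pad_right :: "nat \<Rightarrow> 'a word \<Rightarrow> 'a option word" where
  "pad_right n w = map Some w @ replicate (n - length w) None"

definition padded_pair :: "'a word \<Rightarrow> 'a word \<Rightarrow> ('a option \<times> 'a option) word" where
  "padded_pair w u =
     (let n = max (length w) (length u) in zip (pad_right n w) (pad_right n u))"

definition word_value :: "('m, 'b) monoid_scheme \<Rightarrow> 'm word \<Rightarrow> 'm" where
  "word_value S w = foldr (mult S) w (one S)"

text \<open>A generating set is a subset of the monoid, so a word over it is a list of elements, and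
  the natural map sends this word to its product.  In \<open>automatic_structure\<close>, \<open>x\<close> ranges over
  the words of length at most one over \<open>X\<close>, that is, over \<open>X \<union> {\<epsilon>}\<close>.\<close>

definition generates :: "('m, 'b) monoid_scheme \<Rightarrow> 'm set \<Rightarrow> bool" where
  "generates S X \<longleftrightarrow> X \<subseteq> carrier S \<and> word_value S ` lists X = carrier S"

definition automatic_structure :: "('m, 'b) monoid_scheme \<Rightarrow> 'm set \<Rightarrow> 'm word set \<Rightarrow> bool" where
  "automatic_structure S X L \<longleftrightarrow>
     regular_language X L \<and>
     word_value S ` L = carrier S \<and>
     (\<forall>x \<in> insert [] ((\<lambda>a. [a]) ` X).
        regular_language (padded_alphabet X)
          {padded_pair w u |w u. w \<in> L \<and> u \<in> L \<and> word_value S (w @ x) = word_value S u})"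

definition automatic :: "('m, 'b) monoid_scheme \<Rightarrow> bool" where
  "automatic S \<longleftrightarrow> monoid S \<and>
     (\<exists>X L. finite X \<and> generates S X \<and> automatic_structure S X L)"

end

theory Submission
  imports Defs "HOL-Library.Sublist"
begin

text \<open>Two congruent words with different last letters end, up to congruence, in the two sides of one
  defining relation, applied behind a common word; this cell is unique.  Consequently the monoid is
  cancellative, and an element has at most two predecessors in its right Cayley graph.

  Call a factor of a defining word, or a single letter, a block, and let the block length of a word be
  the least number of blocks of which it is the product.  No defining word is a product of two pieces,
  so every occurrence of a defining word adds exactly one to the block length; hence block length is
  invariant under the congruence.  Over the blocks as generators, the geodesics representing
  neighbouring elements therefore have lengths that differ by at most one.

  If \<open>a p\<close> and \<open>b q\<close> are congruent, where \<open>a\<close> and \<open>b\<close> have the same block length, split off the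
  longest possible common right factor from \<open>p\<close> and \<open>q\<close>.  Unless it is \<open>a\<close> or \<open>b\<close>, the remaining common
  right multiple of \<open>a\<close> and \<open>b\<close> is the end of a cell.  If it were far from both \<open>a\<close> and \<open>b\<close>, then the
  two sides of this cell, and again the two sides of the cells that obstruct them, would all be
  obstructed by other cells; this makes both sides of some relation a product of three pieces, which
  is excluded by \<open>\<parallel>L\<parallel> + \<parallel>R\<parallel> \<ge> 7\<close>.  So congruence of the continuations of \<open>a\<close> and \<open>b\<close> is decided by
  finitely many data, and the set of all geodesics is an automatic structure.\<close>

section \<open>Derivations by the relations, with a bound on their length\<close>

section \<open>Derivations\<close>

definition rel :: "('a word \<times> 'a word) set \<Rightarrow> 'a word \<Rightarrow> 'a word \<Rightarrow> bool" where
  "rel E U V \<longleftrightarrow> (U, V) \<in> E \<or> (V, U) \<in> E"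

lemma rel_sym: "rel E U V \<Longrightarrow> rel E V U"
  by (auto simp: rel_def)

lemma rel_defining_words: "rel E U V \<Longrightarrow> U \<in> defining_words E"
  by (force simp: rel_def defining_words_def)

lemma ex_rel: "W \<in> defining_words E \<Longrightarrow> \<exists>V. rel E W V"
  by (auto simp: rel_def defining_words_def)

lemma pieceI:
  assumes "U1 @ P @ U2 \<in> defining_words E" "V1 @ P @ V2 \<in> defining_words E" "U1 \<noteq> V1 \<or> U2 \<noteq> V2"
  shows "piece E P"
  using assms unfolding piece_def by blast

lemma not_piece_unique:
  assumes "\<not> piece E P" "U1 @ P @ U2 \<in> defining_words E" "V1 @ P @ V2 \<in> defining_words E"
  shows "U1 = V1 \<and> U2 = V2"
  using assms pieceI by blast

text \<open>The index is only an upper bound for the length of a derivation.\<close>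

inductive eqn :: "('a word \<times> 'a word) set \<Rightarrow> nat \<Rightarrow> 'a word \<Rightarrow> 'a word \<Rightarrow> bool" for E where
  refl: "eqn E n w w"
| step: "rel E U V \<Longrightarrow> eqn E n (a @ V @ b) u \<Longrightarrow> eqn E (Suc n) (a @ U @ b) u"

lemma eqn_mono: "eqn E n u v \<Longrightarrow> n \<le> m \<Longrightarrow> eqn E m u v"
proof (induction arbitrary: m rule: eqn.induct)
  case (step U V n a b u)
  then obtain m' where "m = Suc m'" "n \<le> m'" by (metis Suc_le_D Suc_le_mono)
  with step show ?case by (auto intro: eqn.step)
qed (rule eqn.refl)

lemma eqn_trans: "eqn E m u v \<Longrightarrow> eqn E n v w \<Longrightarrow> eqn E (m + n) u w"
proof (induction rule: eqn.induct)
  case (refl k w') then show ?case using eqn_mono by force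
next
  case (step U V k a b u) then show ?case by (auto intro: eqn.step)
qed

lemma eqn_single: "rel E U V \<Longrightarrow> eqn E (Suc 0) (a @ U @ b) (a @ V @ b)"
  by (auto intro: eqn.intros)

lemma eqn_sym: "eqn E n u v \<Longrightarrow> eqn E n v u"
proof (induction rule: eqn.induct)
  case (step U V n a b u)
  then have "eqn E (n + Suc 0) u (a @ U @ b)"
    using eqn_trans eqn_single rel_sym by metis
  then show ?case by simp
qed (rule eqn.refl)

lemma eqn_context: "eqn E n u v \<Longrightarrow> eqn E n (a @ u @ b) (a @ v @ b)"
proof (induction rule: eqn.induct)
  case (step U V n c d u)
  then show ?case using eqn.step[of E U V n "a @ c" "d @ b"] by simp
qed (rule eqn.refl)

lemma eqn_append: "eqn E n u v \<Longrightarrow> eqn E n (u @ b) (v @ b)"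
  using eqn_context[of E n u v "[]" b] by simp

definition cong :: "('a word \<times> 'a word) set \<Rightarrow> 'a word \<Rightarrow> 'a word \<Rightarrow> bool" where
  "cong E u v \<longleftrightarrow> (\<exists>n. eqn E n u v)"

lemma cong_refl [simp, intro]: "cong E u u"
  by (auto simp: cong_def intro: eqn.refl)

lemma cong_sym: "cong E u v \<Longrightarrow> cong E v u"
  by (auto simp: cong_def intro: eqn_sym)

lemma cong_trans [trans]: "cong E u v \<Longrightarrow> cong E v w \<Longrightarrow> cong E u w"
  using eqn_trans unfolding cong_def by blast

lemma cong_context: "cong E u v \<Longrightarrow> cong E (a @ u @ b) (a @ v @ b)"
  by (auto simp: cong_def intro: eqn_context)

lemma cong_append: "cong E u v \<Longrightarrow> cong E u' v' \<Longrightarrow> cong E (u @ u') (v @ v')"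
  using cong_context[of E u v "[]" u'] cong_context[of E u' v' v "[]"] cong_trans by fastforce

lemma cong_rel: "rel E U V \<Longrightarrow> cong E U V"
  using eqn_single[of E U V "[]" "[]"] by (auto simp: cong_def)

section \<open>Last letters of congruent words, uniqueness of cells, and right cancellation\<close>

section \<open>Cells\<close>

text \<open>The consequences of \<open>K32\<close> on which the geometry rests, stated for the
  symmetric \<open>rel\<close>. Here \<open>rel_unique\<close> comes from the distinctness of the
  defining words and \<open>not_two_pieces\<close> from piece-length at least 3.\<close>

locale small_overlap =
  fixes E :: "('a word \<times> 'a word) set"
  assumes rel_unique: "rel E U V \<Longrightarrow> rel E U V' \<Longrightarrow> V = V'"
    and rel_nonempty: "rel E U V \<Longrightarrow> U \<noteq> []"
    and rel_hd: "rel E U V \<Longrightarrow> hd U \<noteq> hd V"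
    and rel_last: "rel E U V \<Longrightarrow> last U \<noteq> last V"
    and not_two_pieces: "W \<in> defining_words E \<Longrightarrow> piece E P \<Longrightarrow> piece E Q \<Longrightarrow> W \<noteq> P @ Q"
begin

abbreviation "D \<equiv> defining_words E"
abbreviation eq (infix "\<approx>" 50) where "u \<approx> v \<equiv> cong E u v"

lemma D_nonempty: "W \<in> D \<Longrightarrow> W \<noteq> []"
  using ex_rel rel_nonempty by blast

lemma piece_Nil: "W \<in> D \<Longrightarrow> piece E []"
  using D_nonempty[of W] by (intro pieceI[of "[]" "[]" W E W "[]"]) auto

lemma D_not_piece: "W \<in> D \<Longrightarrow> \<not> piece E W"
  using not_two_pieces[of W W "[]"] piece_Nil by auto

text \<open>A defining word properly inside another one would be a piece, hence the product of
  itself and the empty piece.\<close>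

lemma D_factor: "U @ W @ V \<in> D \<Longrightarrow> W \<in> D \<Longrightarrow> U = [] \<and> V = []"
  using not_piece_unique[of E W U V "[]" "[]"] D_not_piece by auto

text \<open>The dichotomy that compares two congruent words by their last letters. The strict bound
  \<open>i + j < n\<close> reserves one step for the cell itself and drives the inductions on
  derivation length.\<close>

definition ends :: "nat \<Rightarrow> bool" where
  "ends n \<longleftrightarrow> (\<forall>w x u y. eqn E n (w @ [x]) (u @ [y]) \<longrightarrow>
     x = y \<and> eqn E n w u \<or>
     (\<exists>t V U i j. rel E (V @ [x]) (U @ [y]) \<and> eqn E i w (t @ V) \<and> eqn E j (t @ U) u \<and> i + j < n))"

text \<open>The two sides of a relation have different last letters, so equal last letters rule out
  the cell, and letters can be removed one at a time.\<close>

lemma ends_cancel: "ends n \<Longrightarrow> eqn E n (w @ z) (u @ z) \<Longrightarrow> eqn E n w u"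
proof (induction z rule: rev_induct)
  case (snoc x z)
  then have "eqn E n (w @ z) (u @ z)"
    using rel_last unfolding ends_def append_assoc[symmetric] by (metis last_snoc)
  with snoc show ?case by simp
qed simp

text \<open>Infinite descent: the cell behind a corner produces a corner with a shorter derivation.\<close>

lemma no_corner_eqn:
  assumes "\<forall>k\<le>m. ends k" "eqn E m (t @ A) (s @ B)" "A \<noteq> []" "B \<noteq> []" "last A \<noteq> last B"
    and "B @ C \<in> D" "C \<noteq> []" "\<not> piece E B"
  shows False
  using assms
proof (induction m arbitrary: t A s B C rule: less_induct)
  case (less m)
  obtain A0 x B0 y where AB: "A = A0 @ [x]" "B = B0 @ [y]" "x \<noteq> y"
    using less.prems by (metis append_butlast_last_id)
  have "eqn E m ((t @ A0) @ [x]) ((s @ B0) @ [y])"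
    using less.prems(2) AB by simp
  then obtain r W U i j where cell: "rel E (W @ [x]) (U @ [y])" "eqn E i (t @ A0) (r @ W)"
      "eqn E j (r @ U) (s @ B0)" "i + j < m"
    using less.prems(1) AB(3) unfolding ends_def by blast
  have UD: "U @ [y] \<in> D"
    using cell(1) rel_sym rel_defining_words by blast
  \<comment> \<open>Follow the side of the new cell backwards along \<open>B\<close> while the two
    agree. The shared part \<open>z @ [y]\<close> is a piece, because \<open>B\<close> continues
    with the nonempty \<open>C\<close> while the side of the cell ends here. So \<open>B1\<close> is
    nonempty, \<open>U1\<close> is no piece, and they form the next corner.\<close>
  obtain z B1 U1 where z: "B0 = B1 @ z" "U = U1 @ z" "B1 = [] \<or> U1 = [] \<or> last B1 \<noteq> last U1"
    using longest_common_suffix by blast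
  have BD: "B1 @ (z @ [y]) @ C \<in> D"
    using less.prems(6) AB z by simp
  have UD': "U1 @ (z @ [y]) @ [] \<in> D"
    using UD z by simp
  have p: "piece E (z @ [y])"
    using pieceI[OF BD UD'] less.prems(7) by blast
  have 1: "B1 \<noteq> []"
    using p less.prems(8) AB z by auto
  have 2: "\<not> piece E U1"
    using not_two_pieces[OF UD', of U1 "z @ [y]"] p by auto
  then have 3: "U1 \<noteq> []" using piece_Nil[OF UD] by auto
  have "eqn E j (r @ U1) (s @ B1)"
    using ends_cancel[of j "r @ U1" z "s @ B1"] cell z less.prems(1) by simp
  then have "eqn E j (s @ B1) (r @ U1)" by (rule eqn_sym)
  moreover have "last B1 \<noteq> last U1" using 1 3 z by blast
  ultimately show False
    using less.IH[of j s B1 r U1 "z @ [y]"] less.prems(1) 1 2 3 cell(4) UD' by auto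
qed

text \<open>Remove the longest common suffix \<open>z\<close>. Unequal remainders would make
  \<open>z @ [y]\<close> a piece, so neither remainder would be one, and they would form a corner
  that \<open>no_corner_eqn\<close> excludes.\<close>

lemma cell_unique_eqn:
  assumes "\<forall>k\<le>m. ends k" "eqn E m (t @ V) (s @ U)" "V @ [y] \<in> D" "U @ [y] \<in> D"
  shows "V = U \<and> eqn E m t s"
proof -
  obtain z V1 U1 where z: "V = V1 @ z" "U = U1 @ z" "V1 = [] \<or> U1 = [] \<or> last V1 \<noteq> last U1"
    using longest_common_suffix by blast
  have VD: "V1 @ (z @ [y]) @ [] \<in> D" and UD: "U1 @ (z @ [y]) @ [] \<in> D"
    using assms z by auto
  have c: "eqn E m (t @ V1) (s @ U1)"
    using ends_cancel[of m "t @ V1" z "s @ U1"] assms z by simp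
  have "V1 = U1"
  proof (rule ccontr)
    assume ne: "V1 \<noteq> U1"
    then have p: "piece E (z @ [y])" using pieceI[OF VD UD] by blast
    have V: "\<not> piece E V1" and U: "\<not> piece E U1"
      using not_two_pieces[OF VD, of V1 "z @ [y]"] not_two_pieces[OF UD, of U1 "z @ [y]"] p by auto
    then have "V1 \<noteq> []" "U1 \<noteq> []" using piece_Nil[OF VD] by auto
    then show False
      using no_corner_eqn[OF assms(1) c, of "z @ [y]"] z UD U by auto
  qed
  moreover have "eqn E m t s" using c ends_cancel assms(1) \<open>V1 = U1\<close> by blast
  ultimately show ?thesis using z by simp
qed

text \<open>Induction on the length, by the first step of the derivation. A step that spares the
  last letter is prepended to the derivation of the left part. A step at the very end is either the
  required cell or is cancelled by the cell that the induction hypothesis yields.\<close>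

lemma all_ends: "ends n"
proof (induction n rule: less_induct)
  case (less n)
  show ?case
    unfolding ends_def
  proof (intro allI impI)
    fix w x u y
    assume "eqn E n (w @ [x]) (u @ [y])"
    then show "x = y \<and> eqn E n w u \<or>
     (\<exists>t V U i j. rel E (V @ [x]) (U @ [y]) \<and> eqn E i w (t @ V) \<and> eqn E j (t @ U) u \<and> i + j < n)"
    proof cases
      case refl
      then show ?thesis by (auto intro: eqn.refl)
    next
      case (step U V m a b)
      have endsm: "ends m" using less step by simp
      show ?thesis
      proof (cases b rule: rev_cases)
        case Nil
        obtain V0 c where V: "V = V0 @ [c]"
          using step(3) rel_sym rel_nonempty by (metis append_butlast_last_id)
        obtain U0 where U: "U = U0 @ [x]" "w = a @ U0"
          using step(2) Nil rel_nonempty[OF step(3)]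
          by (cases U rule: rev_cases) auto
        have "eqn E m ((a @ V0) @ [c]) (u @ [y])" using step(4) Nil V by simp
        with endsm consider
            (same) "c = y" "eqn E m (a @ V0) u"
          | (cell) t P Q i j where "rel E (P @ [c]) (Q @ [y])" "eqn E i (a @ V0) (t @ P)"
              "eqn E j (t @ Q) u" "i + j < m"
          unfolding ends_def by blast
        then show ?thesis
        proof cases
          case same
          then have "rel E (U0 @ [x]) (V0 @ [y])" "eqn E 0 w (a @ U0)" "eqn E m (a @ V0) u" "0 + m < n"
            using step U V by (auto intro: eqn.refl)
          then show ?thesis by blast
        next
          \<comment> \<open>The cell found by induction has a side with the same last letter as
            \<open>V\<close>. By uniqueness this side is \<open>V\<close>, so its partner is
            \<open>U\<close> again and the two cells cancel.\<close>
          case cell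
          have "V0 @ [c] \<in> D" "P @ [c] \<in> D"
            using step(3) V cell(1) rel_sym rel_defining_words by blast+
          moreover have "\<forall>k\<le>i. ends k" using less cell(4) step(1) by simp
          ultimately have *: "V0 = P \<and> eqn E i a t"
            using cell_unique_eqn cell(2) by blast
          then have "Q @ [y] = U"
            using rel_unique[OF cell(1)] rel_sym[OF step(3)] V by blast
          then have xy: "x = y" "Q = U0" using U by auto
          have "eqn E (i + j) (a @ U0) u"
            using * cell(3) xy eqn_append eqn_trans by blast
          then show ?thesis using xy U cell(4) step(1) eqn_mono[of E "i + j" _ _ n] by auto
        qed
      next
        case (snoc b' x')
        then have b: "b = b' @ [x]" "w = a @ U @ b'" using step(2) by auto
        have st: "eqn E (Suc k) w v" if "eqn E k (a @ V @ b') v" for k v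
          using eqn.step[OF step(3) that] b by simp
        have "eqn E m ((a @ V @ b') @ [x]) (u @ [y])" using step(4) b by simp
        with endsm consider
            (same) "x = y" "eqn E m (a @ V @ b') u"
          | (cell) t P Q i j where "rel E (P @ [x]) (Q @ [y])" "eqn E i (a @ V @ b') (t @ P)"
              "eqn E j (t @ Q) u" "i + j < m"
          unfolding ends_def by blast
        then show ?thesis
        proof cases
          case same then show ?thesis using st step(1) by blast
        next
          case cell
          then have "Suc i + j < n" using step(1) by simp
          then show ?thesis using st cell by blast
        qed
      qed
    qed
  qed
qed

lemma last_cases:
  assumes "w @ [x] \<approx> u @ [y]"
  obtains (same) "x = y" "w \<approx> u"
  | (cell) t V U where "rel E (V @ [x]) (U @ [y])" "w \<approx> t @ V" "u \<approx> t @ U"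
  using assms all_ends cong_sym unfolding cong_def ends_def by (metis eqn_sym)

lemma right_cancel: "w @ z \<approx> u @ z \<Longrightarrow> w \<approx> u"
  using ends_cancel all_ends unfolding cong_def by blast

lemma no_corner:
  assumes "t @ A \<approx> s @ B" "A \<noteq> []" "B \<noteq> []" "last A \<noteq> last B"
    and "B @ C \<in> D" "C \<noteq> []"
  shows "piece E B"
  using assms no_corner_eqn all_ends unfolding cong_def by blast

lemma cell_unique:
  assumes "t @ V \<approx> s @ U" "V \<in> D" "U \<in> D" "last V = last U"
  shows "V = U \<and> t \<approx> s"
proof -
  obtain V0 U0 y where VU: "V = V0 @ [y]" "U = U0 @ [y]"
    using assms D_nonempty by (metis append_butlast_last_id)
  then have "t @ V0 \<approx> s @ U0" using right_cancel[of "t @ V0" "[y]" "s @ U0"] assms by simp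
  then show ?thesis
    using cell_unique_eqn all_ends assms VU unfolding cong_def by blast
qed

end

section \<open>Left cancellation\<close>

text \<open>The mirror image of the presentation. The assumptions of \<open>small_overlap\<close>
  are symmetric under reversal, so right cancellation here is left cancellation in the
  original.\<close>

definition rev_pres :: "('a word \<times> 'a word) set \<Rightarrow> ('a word \<times> 'a word) set" where
  "rev_pres E = map_prod rev rev ` E"

lemma rel_rev_pres: "rel (rev_pres E) U V \<longleftrightarrow> rel E (rev U) (rev V)"
  unfolding rel_def rev_pres_def by (force simp: image_iff)

lemma defining_words_rev_pres: "W \<in> defining_words (rev_pres E) \<longleftrightarrow> rev W \<in> defining_words E"
  by (metis ex_rel rel_defining_words rel_rev_pres rev_rev_ident)

lemma piece_rev_pres: "piece (rev_pres E) P \<Longrightarrow> piece E (rev P)"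
proof -
  assume "piece (rev_pres E) P"
  then obtain U1 U2 V1 V2 where *: "U1 @ P @ U2 \<in> defining_words (rev_pres E)"
      "V1 @ P @ V2 \<in> defining_words (rev_pres E)" "U1 \<noteq> V1 \<or> U2 \<noteq> V2"
    unfolding piece_def by metis
  then show ?thesis
    using pieceI[of "rev U2" "rev P" "rev U1" E "rev V2" "rev V1"]
    by (auto simp: defining_words_rev_pres)
qed

lemma eqn_rev_pres: "eqn E n u v \<Longrightarrow> eqn (rev_pres E) n (rev u) (rev v)"
proof (induction rule: eqn.induct)
  case (step U V n a b u)
  then show ?case
    using eqn.step[of "rev_pres E" "rev U" "rev V" n "rev b" "rev a"] by (simp add: rel_rev_pres)
qed (rule eqn.refl)

lemma rev_pres_rev_pres [simp]: "rev_pres (rev_pres E) = E"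
  by (force simp: rev_pres_def image_iff)

lemma cong_rev_pres: "cong (rev_pres E) (rev u) (rev v) \<longleftrightarrow> cong E u v"
  unfolding cong_def using eqn_rev_pres[of E _ u v] eqn_rev_pres[of "rev_pres E" _ "rev u" "rev v"]
  by auto

context small_overlap
begin

lemma small_overlap_rev_pres: "small_overlap (rev_pres E)"
proof
  fix U V V' assume *: "rel (rev_pres E) U V"
  then have r: "rel E (rev U) (rev V)" by (simp add: rel_rev_pres)
  show "U \<noteq> []" using rel_nonempty[OF r] by simp
  have "V \<noteq> []" using rel_nonempty[OF rel_sym[OF r]] by simp
  show "V = V'" if "rel (rev_pres E) U V'"
    using rel_unique[OF r, of "rev V'"] that by (simp add: rel_rev_pres)
  show "hd U \<noteq> hd V" "last U \<noteq> last V"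
    using rel_last[OF r] rel_hd[OF r] \<open>U \<noteq> []\<close> \<open>V \<noteq> []\<close> by (auto simp: last_rev hd_rev)
next
  fix W P Q assume "W \<in> defining_words (rev_pres E)" "piece (rev_pres E) P" "piece (rev_pres E) Q"
  then show "W \<noteq> P @ Q"
    using not_two_pieces[of "rev W" "rev Q" "rev P"] piece_rev_pres
    by (metis defining_words_rev_pres rev_append)
qed

lemma left_cancel: "z @ w \<approx> z @ u \<Longrightarrow> w \<approx> u"
  using small_overlap.right_cancel[OF small_overlap_rev_pres, of "rev w" "rev z" "rev u"]
    cong_rev_pres[of E] by (metis rev_append)

end

section \<open>Block length and its invariance under the congruence\<close>

section \<open>Block length\<close>

text \<open>Single letters make every word a product of blocks; the empty word makes blocks closed
  under taking factors.\<close>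

definition block :: "('a word \<times> 'a word) set \<Rightarrow> 'a word \<Rightarrow> bool" where
  "block E y \<longleftrightarrow> length y \<le> 1 \<or> (\<exists>U V. U @ y @ V \<in> defining_words E)"

definition blen :: "('a word \<times> 'a word) set \<Rightarrow> 'a word \<Rightarrow> nat" where
  "blen E w = (LEAST n. \<exists>ys. length ys = n \<and> concat ys = w \<and> (\<forall>y\<in>set ys. block E y))"

lemma block_factor: "block E (a @ y @ b) \<Longrightarrow> block E y"
  unfolding block_def by (metis append_assoc le_add1 le_add2 length_append order_trans)

lemma block_prefix: "block E (y @ b) \<Longrightarrow> block E y"
  using block_factor[of E "[]" y b] by simp

lemma block_suffix: "block E (a @ y) \<Longrightarrow> block E y"
  using block_factor[of E a y "[]"] by simp

lemma blen_le: "\<forall>y\<in>set ys. block E y \<Longrightarrow> blen E (concat ys) \<le> length ys"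
  unfolding blen_def by (rule Least_le) auto

lemma ex_blocks:
  obtains ys where "concat ys = w" "\<forall>y\<in>set ys. block E y" "length ys = blen E w"
proof -
  have "concat (map (\<lambda>x. [x]) w) = w" by (induction w) auto
  then have "\<exists>ys. length ys = length w \<and> concat ys = w \<and> (\<forall>y\<in>set ys. block E y)"
    by (intro exI[of _ "map (\<lambda>x. [x]) w"]) (auto simp: block_def)
  then have "\<exists>ys. length ys = blen E w \<and> concat ys = w \<and> (\<forall>y\<in>set ys. block E y)"
    unfolding blen_def by (rule LeastI)
  then show ?thesis using that by blast
qed

lemma blen_Nil [simp]: "blen E [] = 0"
  using blen_le[of "[]" E] by simp

lemma blen_block: "block E y \<Longrightarrow> blen E y \<le> 1"
  using blen_le[of "[y]" E] by simp

lemma concat_eq_append: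
  assumes "concat ys = u @ v" "ys \<noteq> []"
  obtains ys1 y1 y2 ys2 where "ys = ys1 @ [y1 @ y2] @ ys2" "concat ys1 @ y1 = u" "y2 @ concat ys2 = v"
  using assms
proof (induction ys arbitrary: u thesis)
  case (Cons y ys)
  show ?case
  proof (cases "ys = []")
    case True
    then show ?thesis using Cons.prems(1)[of "[]" u v "[]"] Cons.prems(2) by simp
  next
    case False
    from Cons.prems(2) consider us where "y = u @ us" "us @ concat ys = v"
      | us where "y @ us = u" "concat ys = us @ v"
      by (auto simp: append_eq_append_conv2)
    then show ?thesis
    proof cases
      case 1
      then show ?thesis using Cons.prems(1)[of "[]" u us ys] by simp
    next
      case 2
      obtain ys1 y1 y2 ys2 where "ys = ys1 @ [y1 @ y2] @ ys2" "concat ys1 @ y1 = us" "y2 @ concat ys2 = v"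
        using Cons.IH[OF _ 2(2) False] by blast
      then show ?thesis using Cons.prems(1)[of "y # ys1" y1 y2 ys2] 2(1) by auto
    qed
  qed
qed simp

lemma blen_append_le: "blen E (u @ v) \<le> blen E u + blen E v"
proof -
  obtain ys where "concat ys = u" "\<forall>y\<in>set ys. block E y" "length ys = blen E u" by (rule ex_blocks)
  moreover obtain zs where "concat zs = v" "\<forall>y\<in>set zs. block E y" "length zs = blen E v" by (rule ex_blocks)
  ultimately show ?thesis using blen_le[of "ys @ zs" E] by auto
qed

text \<open>Cutting a shortest factorization of \<open>u @ v\<close> at the boundary splits at most
  one block into two.\<close>

lemma blen_append_ge:
  shows "blen E u \<le> blen E (u @ v)" "blen E v \<le> blen E (u @ v)"
    and "blen E u + blen E v \<le> blen E (u @ v) + 1"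
proof -
  obtain ys where ys: "concat ys = u @ v" "\<forall>y\<in>set ys. block E y" "length ys = blen E (u @ v)"
    by (rule ex_blocks)
  have *: "blen E u \<le> blen E (u @ v) \<and> blen E v \<le> blen E (u @ v) \<and>
     blen E u + blen E v \<le> blen E (u @ v) + 1"
  proof (cases "ys = []")
    case True
    then show ?thesis using ys by simp
  next
    case False
    obtain ys1 y1 y2 ys2 where s: "ys = ys1 @ [y1 @ y2] @ ys2" "concat ys1 @ y1 = u" "y2 @ concat ys2 = v"
      by (rule concat_eq_append[OF ys(1) False])
    then have "block E y1" "block E y2" using ys(2) block_prefix block_suffix by fastforce+
    then show ?thesis
      using blen_le[of "ys1 @ [y1]" E] blen_le[of "y2 # ys2" E] s ys by auto
  qed
  then show "blen E u \<le> blen E (u @ v)" "blen E v \<le> blen E (u @ v)"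
     "blen E u + blen E v \<le> blen E (u @ v) + 1" by auto
qed

text \<open>Turns bounds on block length into bounds on length, and so into finiteness over a finite
  alphabet.\<close>

lemma length_le_blen:
  assumes "\<forall>W\<in>defining_words E. length W \<le> m" "1 \<le> m"
  shows "length w \<le> m * blen E w"
proof -
  obtain ys where ys: "concat ys = w" "\<forall>y\<in>set ys. block E y" "length ys = blen E w"
    by (rule ex_blocks)
  have "length y \<le> m" if "y \<in> set ys" for y
    using ys(2) that assms unfolding block_def by fastforce
  then have "length (concat ys) \<le> m * length ys"
    by (induction ys) (auto simp: algebra_simps, fastforce)
  then show ?thesis using ys by simp
qed

context small_overlap
begin

text \<open>Take a shortest factorization of \<open>a @ V @ b\<close>. If \<open>V\<close> lies
  inside one block, it is that block by \<open>D_factor\<close>. Otherwise \<open>V\<close> starts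
  in one block and ends in a later one, and the count can only fail if \<open>V\<close> is a product
  of two pieces.\<close>

lemma blen_defining_word_ge:
  assumes V: "V \<in> D"
  shows "blen E a + 1 + blen E b \<le> blen E (a @ V @ b)"
proof -
  obtain ys where ys: "concat ys = a @ V @ b" "\<forall>y\<in>set ys. block E y" "length ys = blen E (a @ V @ b)"
    by (rule ex_blocks)
  have "ys \<noteq> []" using ys(1) D_nonempty[OF V] by auto
  obtain ys1 y1 y2 ys2 where s: "ys = ys1 @ [y1 @ y2] @ ys2" "concat ys1 @ y1 = a" "y2 @ concat ys2 = V @ b"
    by (rule concat_eq_append[OF ys(1) \<open>ys \<noteq> []\<close>])
  have bl: "block E y1" "block E y2" "block E (y1 @ y2)"
    using s ys(2) block_prefix block_suffix by fastforce+
  have a1: "blen E a \<le> length ys1 + 1" and a2: "y1 = [] \<Longrightarrow> blen E a \<le> length ys1"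
    using blen_le[of "ys1 @ [y1]" E] blen_le[of ys1 E] s ys bl by auto
  from s(3) consider (long) y3 where "y2 = V @ y3" "y3 @ concat ys2 = b"
    | (short) V2 where "V = y2 @ V2" "concat ys2 = V2 @ b" "V2 \<noteq> []"
    by (auto simp: append_eq_append_conv2) (metis append_Nil append_Nil2)
  then show ?thesis
  proof cases
    case long
    have "y1 = [] \<and> y3 = []"
    proof (cases "length (y1 @ y2) \<le> 1")
      case True
      then show ?thesis using long D_nonempty[OF V] by (cases V) auto
    next
      case False
      then obtain U1 U2 where "U1 @ (y1 @ V @ y3) @ U2 \<in> D"
        using bl(3) long unfolding block_def by auto
      then show ?thesis using D_factor[of "U1 @ y1" V "y3 @ U2"] V by simp
    qed
    then show ?thesis using a2 long blen_le[of ys2 E] s ys by simp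
  next
    case short
    then have "ys2 \<noteq> []" by auto
    obtain ys3 z1 z2 ys4 where z: "ys2 = ys3 @ [z1 @ z2] @ ys4" "concat ys3 @ z1 = V2" "z2 @ concat ys4 = b"
      by (rule concat_eq_append[OF short(2) \<open>ys2 \<noteq> []\<close>])
    have bz: "block E z1" "block E z2" "block E (z1 @ z2)"
      using s z ys(2) block_prefix block_suffix by fastforce+
    have b1: "blen E b \<le> length ys4 + 1" and b2: "z2 = [] \<Longrightarrow> blen E b \<le> length ys4"
      using blen_le[of "z2 # ys4" E] blen_le[of ys4 E] s z ys bz by auto
    have n: "length ys = length ys1 + length ys3 + length ys4 + 2" using s z by simp
    \<comment> \<open>The critical case: \<open>V\<close> meets two adjacent blocks that both
      protrude. Then \<open>y2\<close> and \<open>z1\<close> also occur at other positions in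
      defining words, so both are pieces.\<close>
    have "ys3 \<noteq> [] \<or> y1 = [] \<or> z2 = []"
    proof (rule ccontr)
      assume "\<not> (ys3 \<noteq> [] \<or> y1 = [] \<or> z2 = [])"
      then have c: "ys3 = []" "y1 \<noteq> []" "z2 \<noteq> []" by auto
      then have V': "V = y2 @ z1" using short z by simp
      have "piece E y2"
      proof (cases "y2 = []")
        case False
        then have "\<not> length (y1 @ y2) \<le> 1" using c by (cases y1; cases y2) auto
        then obtain U1 U2 where "(U1 @ y1) @ y2 @ U2 \<in> D" using bl(3) unfolding block_def by auto
        then show ?thesis using pieceI[of "U1 @ y1" y2 U2 E "[]" z1] V V' c by simp
      qed (use piece_Nil V in blast)
      moreover have "piece E z1"
      proof (cases "z1 = []")
        case False
        then have "\<not> length (z1 @ z2) \<le> 1" using c by (cases z1; cases z2) auto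
        then obtain U1 U2 where "U1 @ z1 @ (z2 @ U2) \<in> D" using bz(3) unfolding block_def by auto
        then show ?thesis using pieceI[of U1 z1 "z2 @ U2" E y2 "[]"] V V' c by simp
      qed (use piece_Nil V in blast)
      ultimately show False using not_two_pieces V V' by blast
    qed
    moreover have "ys3 \<noteq> [] \<Longrightarrow> length ys3 \<ge> 1" by (cases ys3) auto
    ultimately show ?thesis using a1 a2 b1 b2 n ys(3) by fastforce
  qed
qed

lemma blen_defining_word:
  assumes "V \<in> D"
  shows "blen E (a @ V @ b) = blen E a + 1 + blen E b"
proof -
  have "[] @ V @ [] \<in> D" using assms by simp
  then have "blen E V \<le> 1" by (intro blen_block) (unfold block_def, blast)
  then show ?thesis
    using blen_append_le[of E a "V @ b"] blen_append_le[of E V b] blen_defining_word_ge[OF assms, of a b]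
    by linarith
qed

lemma blen_cong: "u \<approx> v \<Longrightarrow> blen E u = blen E v"
proof -
  have "eqn E n u v \<Longrightarrow> blen E u = blen E v" for n
  proof (induction rule: eqn.induct)
    case (step U V n a b u)
    then show ?case
      using blen_defining_word[of U a b] blen_defining_word[of V a b] rel_defining_words rel_sym by metis
  qed simp
  then show "u \<approx> v \<Longrightarrow> blen E u = blen E v" unfolding cong_def by blast
qed

end

section \<open>Obstructing cells and common right multiples of bounded block length\<close>

section \<open>Common right multiples\<close>

text \<open>As soon as there is a defining word the empty word is a piece, so products of fewer
  pieces are covered too.\<close>

definition three_pieces :: "('a word \<times> 'a word) set \<Rightarrow> 'a word \<Rightarrow> bool" where
  "three_pieces E W \<longleftrightarrow> (\<exists>P Q R. piece E P \<and> piece E Q \<and> piece E R \<and> W = P @ Q @ R)"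

context small_overlap
begin

text \<open>The different last letters give a cell that ends at the corner. Its common suffix with
  \<open>B\<close> is a piece, since \<open>B\<close> has the continuation \<open>B'\<close>; so the
  rest of the side is no piece, and \<open>no_corner\<close> leaves nothing of \<open>B\<close>
  outside the cell.\<close>

lemma corner:
  assumes "t @ B \<approx> s @ C" "B \<noteq> []" "C \<noteq> []" "last B \<noteq> last C" "B @ B' \<in> D" "B' \<noteq> []"
  obtains x G1 G' where "rel E (G1 @ B) G'" "G1 \<noteq> []" "t \<approx> x @ G1" "last G' = last C"
    "s @ butlast C \<approx> x @ butlast G'" "s @ C \<approx> x @ G'"
proof -
  obtain B0 d C0 c where BC: "B = B0 @ [d]" "C = C0 @ [c]" "d \<noteq> c"
    using assms by (metis append_butlast_last_id)
  have "(t @ B0) @ [d] \<approx> (s @ C0) @ [c]" using assms(1) BC by simp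
  then obtain x V U where cell: "rel E (V @ [d]) (U @ [c])" "t @ B0 \<approx> x @ V" "s @ C0 \<approx> x @ U"
    using BC(3) by (cases rule: last_cases) auto
  obtain z B1 V1 where z: "B0 = B1 @ z" "V = V1 @ z" "B1 = [] \<or> V1 = [] \<or> last B1 \<noteq> last V1"
    using longest_common_suffix by blast
  have VD: "V1 @ (z @ [d]) @ [] \<in> D" using rel_defining_words[OF cell(1)] z by simp
  have BD: "B1 @ (z @ [d]) @ B' \<in> D" using assms(5) z BC by simp
  have p: "piece E (z @ [d])" using pieceI[OF VD BD] assms(6) by blast
  then have V1: "\<not> piece E V1" using not_two_pieces[OF VD, of V1 "z @ [d]"] by auto
  then have V1ne: "V1 \<noteq> []" using piece_Nil[OF VD] by auto
  have tx: "t @ B1 \<approx> x @ V1" using cell(2) z right_cancel[of "t @ B1" z "x @ V1"] by simp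
  have "B1 = []"
  proof (rule ccontr)
    assume "B1 \<noteq> []"
    then show False
      using no_corner[OF tx _ V1ne, of "z @ [d]"] z V1 V1ne VD by auto
  qed
  then have "rel E (V1 @ B) (U @ [c])" "t \<approx> x @ V1" using cell z BC tx by auto
  moreover have "s @ C \<approx> x @ (U @ [c])" using cong_append[OF cell(3) cong_refl[of E "[c]"]] BC by simp
  ultimately show ?thesis using that[of V1 "U @ [c]" x] V1ne cell(3) BC by simp
qed

text \<open>Follow the path \<open>p\<close> backwards from the vertex \<open>t @ B\<close> as long
  as it runs along \<open>B\<close>. It gets to \<open>t\<close>, or ends at \<open>a\<close> on the
  way, or leaves \<open>B\<close> at a vertex where \<open>corner\<close> supplies an obstructing
  cell. The last case records \<open>butlast W'\<close>, a proper prefix, so that the analysis can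
  be repeated on the opposite side \<open>W'\<close>.\<close>

lemma ancestor_cases:
  assumes "a @ p \<approx> t @ B" "B @ B' \<in> D" "B' \<noteq> []"
  obtains (before) p' where "a @ p' \<approx> t"
  | (on) B1 B2 where "B = B1 @ B2" "a \<approx> t @ B1"
  | (obstructed) B1 B2 W1 W' r p' where "B = B1 @ B2" "B1 \<noteq> []" "W1 \<noteq> []" "rel E (W1 @ B1) W'"
      "t \<approx> r @ W1" "a @ p' \<approx> r @ butlast W'" "a @ p' @ [last W'] \<approx> t @ B1"
proof -
  obtain z p1 B1 where z: "p = p1 @ z" "B = B1 @ z" "p1 = [] \<or> B1 = [] \<or> last p1 \<noteq> last B1"
    using longest_common_suffix by blast
  have c: "a @ p1 \<approx> t @ B1" using right_cancel[of "a @ p1" z "t @ B1"] assms(1) z by simp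
  consider "B1 = []" | "p1 = []" | "p1 \<noteq> []" "B1 \<noteq> []" "last B1 \<noteq> last p1" using z(3) by metis
  then show ?thesis
  proof cases
    case 1 then show ?thesis using before c by simp
  next
    case 2 then show ?thesis using on[of B1 z] c z by simp
  next
    case 3
    have "B1 @ (z @ B') \<in> D" using assms(2) z by simp
    then obtain x G1 G' where g: "rel E (G1 @ B1) G'" "G1 \<noteq> []" "t \<approx> x @ G1" "last G' = last p1"
        "a @ butlast p1 \<approx> x @ butlast G'"
      using corner[OF cong_sym[OF c] 3(2,1,3), of "z @ B'"] assms(3) by blast
    have "a @ butlast p1 @ [last G'] \<approx> t @ B1" using c g(4) 3(1) by simp
    then show ?thesis using obstructed z(2) 3 g by blast
  qed
qed

text \<open>Geometrically, the cells \<open>W1 @ W3\<close> and \<open>U1 @ U3\<close> pass through a common vertex and leave it along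
  the two sides of the cells that start there.\<close>

lemma double_obstruction:
  assumes "r @ W1 \<approx> s @ U1" "W1 @ W3 \<in> D" "U1 @ U3 \<in> D" "W3 @ W4 \<in> D" "U3 @ U4 \<in> D"
    and "W3 \<noteq> []" "U3 \<noteq> []" "W4 \<noteq> []" "U4 \<noteq> []" "hd W3 \<noteq> hd U3"
  obtains W2 U2 M where "W1 = W2 @ M" "U1 = U2 @ M" "W2 \<noteq> []" "U2 \<noteq> []" "last W2 \<noteq> last U2"
    "r @ W2 \<approx> s @ U2" "three_pieces E (W1 @ W3)" "three_pieces E (U1 @ U3)"
proof -
  have W3: "piece E W3" using pieceI[of W1 W3 "[]" E "[]" W4] assms by auto
  have U3: "piece E U3" using pieceI[of U1 U3 "[]" E "[]" U4] assms by auto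
  have W1: "\<not> piece E W1" and U1: "\<not> piece E U1" using W3 U3 not_two_pieces assms by blast+
  \<comment> \<open>\<open>M\<close> is a piece because different letters follow it. The remainders
    cannot be empty, as \<open>W1\<close> and \<open>U1\<close> are no pieces, and
    \<open>no_corner\<close> makes them pieces.\<close>
  obtain M W2 U2 where z: "W1 = W2 @ M" "U1 = U2 @ M" "W2 = [] \<or> U2 = [] \<or> last W2 \<noteq> last U2"
    using longest_common_suffix by blast
  have c: "r @ W2 \<approx> s @ U2" using right_cancel[of "r @ W2" M "s @ U2"] assms(1) z by simp
  have WD: "W2 @ M @ W3 \<in> D" and UD: "U2 @ M @ U3 \<in> D" using assms z by auto
  have M: "piece E M" using pieceI[OF WD UD] assms by auto
  have ne: "W2 \<noteq> []" "U2 \<noteq> []" using M W1 U1 z by auto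
  then have l: "last W2 \<noteq> last U2" using z by auto
  have "piece E U2" using no_corner[OF c ne l UD] assms by auto
  moreover have "piece E W2" using no_corner[OF cong_sym[OF c] ne(2,1) l[symmetric] WD] assms by auto
  ultimately have "three_pieces E (W1 @ W3)" "three_pieces E (U1 @ U3)"
    using M W3 U3 z unfolding three_pieces_def by auto
  then show ?thesis using that z ne l c by blast
qed

lemma block_D_prefix: "B @ C \<in> D \<Longrightarrow> block E B"
  unfolding block_def by (metis append_Nil)

end

text \<open>A sum of piece-lengths of at least 7 leaves at most one side of a relation with
  piece-length at most 3; this is \<open>seven\<close>.\<close>

locale small_overlap7 = small_overlap +
  assumes finite_E: "finite E"
    and seven: "rel E U V \<Longrightarrow> three_pieces E U \<Longrightarrow> \<not> three_pieces E V"
begin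

lemma finite_D: "finite D"
  using finite_E by (simp add: defining_words_def)

definition max_len :: nat where "max_len = Max (insert 1 (length ` D))"

lemma max_len: "1 \<le> max_len" "W \<in> D \<Longrightarrow> length W \<le> max_len"
  unfolding max_len_def using finite_D by auto

lemma length_le: "length w \<le> max_len * blen E w"
  using length_le_blen max_len by blast

theorem common_multiple:
  assumes "a @ p \<approx> b @ q"
  obtains p0 q0 r where "a @ p0 \<approx> b @ q0" "p \<approx> p0 @ r" "q \<approx> q0 @ r"
    "blen E (a @ p0) \<le> blen E a + 2 \<or> blen E (a @ p0) \<le> blen E b + 2"
proof -
  \<comment> \<open>\<open>S\<close> collects the common right factors that can be split off. Their
    length is bounded through the block length of \<open>p\<close>, so a longest one exists.\<close>
  define S where "S r \<longleftrightarrow> (\<exists>p0 q0. a @ p0 \<approx> b @ q0 \<and> p \<approx> p0 @ r \<and> q \<approx> q0 @ r)" for r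
  have "S []" using assms unfolding S_def by auto
  moreover have "length r < Suc (max_len * blen E p)" if r: "S r" for r
  proof -
    obtain p0 where "p \<approx> p0 @ r" using r unfolding S_def by blast
    then have "blen E r \<le> blen E p" using blen_cong blen_append_ge(2) by metis
    then show ?thesis using length_le[of r] by (meson le_imp_less_Suc mult_le_mono2 order_trans)
  qed
  ultimately obtain r where "S r" and mx: "S r' \<Longrightarrow> length r' \<le> length r" for r'
    using ex_has_greatest_nat[of S "[]" length] by (metis less_Suc_eq_le)
  then obtain p0 q0 where 0: "a @ p0 \<approx> b @ q0" "p \<approx> p0 @ r" "q \<approx> q0 @ r"
    unfolding S_def by blast
  \<comment> \<open>Maximality in usable form: a common multiple from which \<open>a @ p0\<close> is
    reached by \<open>z\<close> would lengthen the factor by \<open>z\<close>.\<close>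
  have ext: "z = []" if z: "a @ p1 \<approx> b @ q1" "a @ p0 \<approx> a @ p1 @ z" for p1 q1 z
  proof -
    have "p0 \<approx> p1 @ z" using left_cancel z(2) by blast
    have "b @ q0 \<approx> (a @ p1) @ z" using 0(1) z(2) cong_sym cong_trans by (metis append_assoc)
    also have "\<dots> \<approx> (b @ q1) @ z" using z(1) cong_append by blast
    finally have "q0 \<approx> q1 @ z" using left_cancel by simp
    have "p \<approx> p1 @ (z @ r)" "q \<approx> q1 @ (z @ r)"
      using 0 \<open>p0 \<approx> p1 @ z\<close> \<open>q0 \<approx> q1 @ z\<close> cong_append cong_trans cong_refl by (metis append_assoc)+
    then show ?thesis using mx[of "z @ r"] z(1) unfolding S_def by fastforce
  qed
  have "blen E (a @ p0) \<le> blen E a + 2 \<or> blen E (a @ p0) \<le> blen E b + 2"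
  proof (cases "p0 = [] \<or> q0 = []")
    case True
    then show ?thesis using blen_cong[OF 0(1)] by auto
  next
    case False
    then obtain p1 x q1 y where pq: "p0 = p1 @ [x]" "q0 = q1 @ [y]" by (metis rev_exhaust)
    have "(a @ p1) @ [x] \<approx> (b @ q1) @ [y]" using 0(1) pq by simp
    then show ?thesis
    proof (cases rule: last_cases)
      case same
      then show ?thesis using ext[of p1 q1 "[x]"] pq by auto
    next
      case (cell t V U)
      have VD: "V @ [x] \<in> D" and UD: "U @ [y] \<in> D"
        using cell(1) rel_sym rel_defining_words by blast+
      have sV: "a @ p0 \<approx> t @ V @ [x]"
        using cong_append[OF cell(2) cong_refl[of E "[x]"]] pq by simp
      have sU: "a @ p0 \<approx> t @ U @ [y]"
        using cong_trans[OF 0(1)] cong_append[OF cell(3) cong_refl[of E "[y]"]] pq by simp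
      \<comment> \<open>The cell adds one block, so it suffices to bound the block length of
        \<open>t\<close> by that of \<open>a\<close> or \<open>b\<close> plus one.\<close>
      have bs: "blen E (a @ p0) = blen E t + 1"
        using blen_cong[OF sV] blen_defining_word[OF VD, of t "[]"] by simp
      \<comment> \<open>If one word reaches \<open>t\<close> and the other a vertex on the side
        leading away from \<open>t\<close>, that vertex is a common multiple before the end of the
        cell, against maximality; \<open>ba\<close> is the mirror case.\<close>
      have ab: False if h: "a @ p' \<approx> t" "U = C1 @ C2" "b @ q' \<approx> t @ C1" for p' C1 C2 q'
      proof -
        have "a @ (p' @ C1) \<approx> t @ C1" using cong_append[OF h(1) cong_refl[of E C1]] by simp
        then have 1: "a @ (p' @ C1) \<approx> b @ q'" using h(3) cong_sym cong_trans by blast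
        have "t @ U @ [y] \<approx> (a @ p') @ U @ [y]" by (rule cong_append[OF cong_sym[OF h(1)] cong_refl])
        then have "a @ p0 \<approx> a @ (p' @ C1) @ (C2 @ [y])" using sU cong_trans h(2) by auto
        then show False using ext[OF 1] by blast
      qed
      have ba: False if h: "b @ q' \<approx> t" "V = C1 @ C2" "a @ p' \<approx> t @ C1" for q' C1 C2 p'
      proof -
        have "b @ (q' @ C1) \<approx> t @ C1" using cong_append[OF h(1) cong_refl[of E C1]] by simp
        then have 1: "a @ p' \<approx> b @ (q' @ C1)" using h(3) cong_sym cong_trans by blast
        have "t @ C1 @ (C2 @ [x]) \<approx> (a @ p') @ (C2 @ [x])"
          using cong_append[OF cong_sym[OF h(3)] cong_refl[of E "C2 @ [x]"]] by simp
        then have "a @ p0 \<approx> a @ p' @ (C2 @ [x])" using sV cong_trans h(2) by auto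
        then show False using ext[OF 1] by blast
      qed
      show ?thesis
      proof (cases rule: ancestor_cases[OF cell(2) VD])
        case (2 p')
        show ?thesis
        proof (cases rule: ancestor_cases[OF cell(3) UD])
          case (2 q') show ?thesis using ab[OF \<open>a @ p' \<approx> t\<close>, of "[]" U q'] 2 by simp
        next
          case (3 B1 B2)
          then show ?thesis using bs blen_cong[OF 3(2)] blen_append_ge(1)[of E t B1] by simp
        next
          case (4 C1 C2 U1 U' s q')
          then show ?thesis using ab[OF \<open>a @ p' \<approx> t\<close>, of C1 C2 "q' @ [last U']"] by simp
        qed simp
      next
        case (3 B1 B2)
        then show ?thesis using bs blen_cong[OF 3(2)] blen_append_ge(1)[of E t B1] by simp
      next
        case W: (4 B1 B2 W1 W' r3 p3)
        show ?thesis
        proof (cases rule: ancestor_cases[OF cell(3) UD])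
          case (2 q')
          then show ?thesis using ba[of q' B1 B2 "p3 @ [last W']"] W by simp
        next
          case (3 C1 C2)
          then show ?thesis using bs blen_cong[OF 3(2)] blen_append_ge(1)[of E t C1] by simp
        next
          case U: (4 C1 C2 U1 U' r4 q3)
          have WD: "W1 @ B1 \<in> D" "W' \<in> D" and UD': "U1 @ C1 \<in> D" "U' \<in> D"
            using W(4) U(4) rel_sym rel_defining_words by blast+
          have "hd (V @ [x]) \<noteq> hd (U @ [y])" using rel_hd[OF cell(1)] .
          then have h: "hd B1 \<noteq> hd C1" using W(1,2) U(1,2) by simp
          \<comment> \<open>Both paths are obstructed. The sides \<open>W1 @ B1\<close> and
            \<open>U1 @ C1\<close> run through \<open>t\<close> and part there along
            \<open>V\<close> and \<open>U\<close>; \<open>double_obstruction\<close> locates the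
            corner before \<open>t\<close> from which they share \<open>M\<close>.\<close>
          have "r3 @ W1 \<approx> r4 @ U1" using W(5) U(5) cong_sym cong_trans by blast
          then obtain W2 U2 M where d: "W1 = W2 @ M" "U1 = U2 @ M" "W2 \<noteq> []" "U2 \<noteq> []"
              "last W2 \<noteq> last U2" "r3 @ W2 \<approx> r4 @ U2"
            using double_obstruction[of r3 W1 r4 U1 B1 C1 "B2 @ [x]" "C2 @ [y]"] WD(1) UD'(1) VD UD
              W(1,2) U(1,2) h
            by (metis append_assoc snoc_eq_iff_butlast)
          have MB: "W2 @ (M @ B1) \<in> D" "M @ B1 \<noteq> []" and MC: "U2 @ (M @ C1) \<in> D" "M @ C1 \<noteq> []"
            using WD UD' d W(2) U(2) by auto
          \<comment> \<open>This corner is the end of a cell with a side ending in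
            \<open>W2\<close>, and likewise of one with a side ending in \<open>U2\<close>. By
            uniqueness these are the two sides of one relation.\<close>
          obtain x1 G1 G' where g: "rel E (G1 @ W2) G'" "r3 \<approx> x1 @ G1" "last G' = last U2"
              "r4 @ U2 \<approx> x1 @ G'"
            using corner[OF d(6,3,4,5) MB] by metis
          obtain x2 H1 H' where g2: "rel E (H1 @ U2) H'" "r4 \<approx> x2 @ H1"
            using corner[OF cong_sym[OF d(6)] d(4,3) d(5)[symmetric] MC] by metis
          have "x1 @ G' \<approx> x2 @ (H1 @ U2)"
            using cong_append[OF g2(2) cong_refl[of E U2]] g(4) cong_sym cong_trans by (metis append_assoc)
          then have G': "G' = H1 @ U2"
            using cell_unique[of x1 G' x2 "H1 @ U2"] g g2(1) d(4) rel_sym rel_defining_words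
            by (metis last_appendR)
          have W'D: "butlast W' @ [last W'] \<in> D" and U'D: "butlast U' @ [last U'] \<in> D"
            using WD UD' D_nonempty by auto
          have hW: "hd W2 \<noteq> hd W'" using rel_hd[OF W(4)] d by simp
          have hU: "hd U2 \<noteq> hd U'" using rel_hd[OF U(4)] d by simp
          have bl: "blen E W1 \<le> 1" "blen E U1 \<le> 1"
            using block_D_prefix WD UD' blen_block by blast+
          have t1: "blen E t \<le> blen E r3 + 1" "blen E t \<le> blen E r4 + 1"
            using blen_cong[OF W(5)] blen_cong[OF U(5)] bl blen_append_le[of E r3 W1] blen_append_le[of E r4 U1]
            by auto
          \<comment> \<open>Now test the opposite side \<open>W'\<close>. If \<open>a\<close> lies
            on it, the block length of \<open>t\<close> exceeds that of \<open>a\<close> by at most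
            one, whence the constant 2. If \<open>a\<close> reaches \<open>r3\<close>, it also
            reaches \<open>t\<close>, against maximality.\<close>
          show ?thesis
          proof (cases rule: ancestor_cases[OF W(6) W'D])
            case (2 p')
            then have "a @ (p' @ W1) \<approx> r3 @ W1" using cong_append[OF 2 cong_refl[of E W1]] by simp
            then have "a @ (p' @ W1) \<approx> t" using W(5) cong_sym cong_trans by blast
            then show ?thesis using ab[OF _ U(1), of "p' @ W1" "q3 @ [last U']"] U(7) by simp
          next
            case (3 P1 P2)
            then show ?thesis using bs t1 blen_cong[OF 3(2)] blen_append_ge(1)[of E r3 P1] by simp
          next
            case Y: (4 Y1 Y2 Z1 Z' z p4)
            show ?thesis
            proof (cases rule: ancestor_cases[OF U(6) U'D])
              case (2 q')
              then have "b @ (q' @ U1) \<approx> r4 @ U1" using cong_append[OF 2 cong_refl[of E U1]] by simp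
              then have "b @ (q' @ U1) \<approx> t" using U(5) cong_sym cong_trans by blast
              then show ?thesis using ba[OF _ W(1), of "q' @ U1" "p3 @ [last W']"] W(7) by simp
            next
              case (3 P1 P2)
              then show ?thesis using bs t1 blen_cong[OF 3(2)] blen_append_ge(1)[of E r4 P1] by simp
            next
              case T: (4 T1 T2 Q1 Q' s q4)
              have W': "W' = Y1 @ Y2 @ [last W']" and U': "U' = T1 @ T2 @ [last U']"
                using Y(1) T(1) WD(2) UD'(2) D_nonempty by (metis append_assoc append_butlast_last_id)+
              \<comment> \<open>Further cells obstruct \<open>W'\<close> at \<open>r3\<close> and
                \<open>U'\<close> at \<open>r4\<close>. With the cell between them they form double
                obstructions, so both of its sides are products of three pieces.\<close>
              have "x1 @ G1 \<approx> z @ Z1" using g(2) Y(5) cong_sym cong_trans by blast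
              then have 1: "three_pieces E (G1 @ W2)"
                using double_obstruction[of x1 G1 z Z1 W2 Y1 "M @ B1" "Y2 @ [last W']"]
                  rel_defining_words[OF g(1)] rel_defining_words[OF Y(4)] WD d W(2) Y(2) W' hW
                by (metis Nil_is_append_conv append_assoc hd_append2 not_Cons_self2)
              have "x2 @ H1 \<approx> s @ Q1" using g2(2) T(5) cong_sym cong_trans by blast
              then have 2: "three_pieces E (H1 @ U2)"
                using double_obstruction[of x2 H1 s Q1 U2 T1 "M @ C1" "T2 @ [last U']"]
                  rel_defining_words[OF g2(1)] rel_defining_words[OF T(4)] UD' d U(2) T(2) U' hU
                by (metis Nil_is_append_conv append_assoc hd_append2 not_Cons_self2)
              show ?thesis using seven[OF g(1) 1] 2 G' by simp
            qed simp
          qed simp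
        qed simp
      qed simp
    qed
  qed
  with 0 that show ?thesis by blast
qed

end

section \<open>Regularity from finitely many residuals\<close>

definition residual :: "'a set \<Rightarrow> 'a word set \<Rightarrow> 'a word \<Rightarrow> 'a word set" where
  "residual A K u = {z \<in> lists A. u @ z \<in> K}"

text \<open>The Myhill-Nerode construction: residuals are the states, and \<open>h\<close> numbers
  them.\<close>

lemma regular_language_residuals:
  assumes A: "finite A" and K: "K \<subseteq> lists A" and fin: "finite (residual A K ` lists A)"
  shows "regular_language A K"
proof -
  define Q where "Q = residual A K ` lists A"
  obtain h :: "'a word set \<Rightarrow> nat" where h: "inj_on h Q"
    using finite_imp_inj_to_nat_seg fin unfolding Q_def by metis
  define step where "step q a = h {z \<in> lists A. a # z \<in> inv_into Q h q}" for q a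
  have res: "residual A K u \<in> Q" if "u \<in> lists A" for u using that by (simp add: Q_def)
  have step: "step (h (residual A K u)) a = h (residual A K (u @ [a]))" if "u \<in> lists A" "a \<in> A" for u a
  proof -
    have "{z \<in> lists A. a # z \<in> residual A K u} = residual A K (u @ [a])"
      using that by (auto simp: residual_def)
    then show ?thesis using inv_into_f_f[OF h res[OF that(1)]] by (simp add: step_def)
  qed
  have run: "foldl step (h (residual A K [])) w = h (residual A K w)" if "w \<in> lists A" for w
    using that by (induction w rule: rev_induct) (auto simp: step)
  show ?thesis
    unfolding regular_language_def
  proof (intro conjI exI)
    show "finite (h ` Q)" using fin by (simp add: Q_def)
    show "h (residual A K []) \<in> h ` Q" using res by simp
    show "h ` {R \<in> Q. [] \<in> R} \<subseteq> h ` Q" by auto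
    show "\<forall>q\<in>h ` Q. \<forall>a\<in>A. step q a \<in> h ` Q"
      using step res by (auto simp: Q_def)
    have mem: "h (residual A K w) \<in> h ` {R \<in> Q. [] \<in> R} \<longleftrightarrow> w \<in> K" if "w \<in> lists A" for w
    proof -
      have "[] \<in> residual A K w \<longleftrightarrow> w \<in> K" by (simp add: residual_def)
      then show ?thesis
        using inj_on_image_mem_iff[OF h res[OF that], of "{R \<in> Q. [] \<in> R}"] res[OF that] by auto
    qed
    show "K = {w \<in> lists A. foldl step (h (residual A K [])) w \<in> h ` {R \<in> Q. [] \<in> R}}"
    proof (rule Set.set_eqI)
      fix w
      show "w \<in> K \<longleftrightarrow> w \<in> {w \<in> lists A. foldl step (h (residual A K [])) w \<in> h ` {R \<in> Q. [] \<in> R}}"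
        using K run[of w] mem[of w] by (cases "w \<in> lists A") (simp_all del: in_lists_conv_set, blast)
    qed
  qed (use A in auto)
qed

text \<open>Applied with \<open>h\<close> the finite data that decide the value of \<open>g\<close>,
  such as a residual.\<close>

lemma finite_image_factor:
  assumes "finite (h ` A)" "\<And>x y. x \<in> A \<Longrightarrow> y \<in> A \<Longrightarrow> h x = h y \<Longrightarrow> g x = g y"
  shows "finite (g ` A)"
proof -
  have "g x = g (SOME y. y \<in> A \<and> h y = h x)" if "x \<in> A" for x
  proof -
    have "(SOME y. y \<in> A \<and> h y = h x) \<in> A \<and> h (SOME y. y \<in> A \<and> h y = h x) = h x"
      using someI[of "\<lambda>y. y \<in> A \<and> h y = h x" x] that by blast
    then show ?thesis using assms(2)[OF that] by simp
  qed
  then have "g ` A \<subseteq> (\<lambda>t. g (SOME y. y \<in> A \<and> h y = t)) ` (h ` A)" by (auto simp: image_iff)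
  then show ?thesis using assms(1) finite_surj by blast
qed

section \<open>Padded pairs\<close>

text \<open>Together with \<open>snds\<close> this undoes the padding. Both respect concatenation,
  so they also read off the components of a suffix.\<close>

definition fsts :: "('a option \<times> 'a option) word \<Rightarrow> 'a word" where
  "fsts z = map the (filter (\<lambda>c. c \<noteq> None) (map fst z))"

definition snds :: "('a option \<times> 'a option) word \<Rightarrow> 'a word" where
  "snds z = map the (filter (\<lambda>c. c \<noteq> None) (map snd z))"

lemma fsts_append [simp]: "fsts (y @ z) = fsts y @ fsts z"
  by (simp add: fsts_def)

lemma snds_append [simp]: "snds (y @ z) = snds y @ snds z"
  by (simp add: snds_def)

lemma pad_right_strip: "map the (filter (\<lambda>c. c \<noteq> None) (pad_right n w)) = w"
  by (simp add: pad_right_def comp_def)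

lemma length_pad_right: "length w \<le> n \<Longrightarrow> length (pad_right n w) = n"
  by (simp add: pad_right_def)

lemma length_padded_pair [simp]: "length (padded_pair w u) = max (length w) (length u)"
  by (simp add: padded_pair_def Let_def length_pad_right)

lemma fsts_padded_pair [simp]: "fsts (padded_pair w u) = w"
  unfolding fsts_def padded_pair_def Let_def
  by (subst map_fst_zip) (simp_all only: length_pad_right max.cobounded1 max.cobounded2 pad_right_strip)

lemma snds_padded_pair [simp]: "snds (padded_pair w u) = u"
  unfolding snds_def padded_pair_def Let_def
  by (subst map_snd_zip) (simp_all only: length_pad_right max.cobounded1 max.cobounded2 pad_right_strip)

lemma padded_pair_append:
  assumes "length a = length b"
  shows "padded_pair (a @ p) (b @ q) = padded_pair a b @ padded_pair p q"
proof -
  have "pad_right (length a + n) (a @ p) = map Some a @ pad_right n p" for a p :: "'a word" and n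
    by (simp add: pad_right_def)
  moreover have "max (length (a @ p)) (length (b @ q)) = length a + max (length p) (length q)"
    using assms by simp
  ultimately show ?thesis
    using assms by (simp add: padded_pair_def Let_def pad_right_def)
qed

lemma padded_pair_lists:
  assumes "w \<in> lists Y" "u \<in> lists Y"
  shows "padded_pair w u \<in> lists (padded_alphabet Y)"
proof -
  let ?n = "max (length w) (length u)"
  have nth: "pad_right ?n v ! i = (if i < length v then Some (v ! i) else None)" if "i < ?n" for v i
    using that by (auto simp: pad_right_def nth_append)
  have "padded_pair w u ! i \<in> padded_alphabet Y" if i: "i < ?n" for i
  proof -
    have "padded_pair w u ! i = (pad_right ?n w ! i, pad_right ?n u ! i)"
      using i by (simp add: padded_pair_def Let_def length_pad_right)
    then show ?thesis
      using i nth[OF i, of w] nth[OF i, of u] assms unfolding padded_alphabet_def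
      by (auto simp: in_lists_conv_set)
  qed
  then have "z \<in> padded_alphabet Y" if "z \<in> set (padded_pair w u)" for z
    using that unfolding in_set_conv_nth by auto
  then show ?thesis unfolding in_lists_conv_set by blast
qed

section \<open>Block length and continuation\<close>

context small_overlap7
begin

lemma block_length: "block E y \<Longrightarrow> length y \<le> max_len"
  using length_le[of y] blen_block[of E y] by (metis mult.right_neutral mult_le_mono2 order_trans)

text \<open>The possible last factors in shortest factorizations of \<open>w\<close>; they are all
  that a continuation of \<open>w\<close> can interact with.\<close>

definition last_blocks :: "'a word \<Rightarrow> 'a word set" where
  "last_blocks w = {v. block E v \<and> (\<exists>u. w = u @ v \<and> blen E u + 1 = blen E w)}"

lemma last_blocks_nonempty: "w \<noteq> [] \<Longrightarrow> last_blocks w \<noteq> {}"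
proof -
  assume "w \<noteq> []"
  obtain ys where ys: "concat ys = w" "\<forall>y\<in>set ys. block E y" "length ys = blen E w"
    by (rule ex_blocks)
  then obtain zs v where z: "ys = zs @ [v]" using \<open>w \<noteq> []\<close> by (cases ys rule: rev_cases) auto
  have "blen E (concat zs) \<le> length zs" "blen E v \<le> 1" "blen E w \<le> blen E (concat zs) + blen E v"
    using ys z blen_le[of zs] blen_block[of E v] blen_append_le[of E "concat zs" v] by auto
  then have "blen E (concat zs) + 1 = blen E w" using ys z by simp
  then show ?thesis using ys z unfolding last_blocks_def by auto
qed

lemma blen_append_last_blocks_le:
  assumes "v \<in> last_blocks w"
  shows "blen E (w @ p) + 1 \<le> blen E w + blen E (v @ p)"
proof -
  obtain u where "w = u @ v" "blen E u + 1 = blen E w" using assms unfolding last_blocks_def by blast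
  then show ?thesis using blen_append_le[of E u "v @ p"] by simp
qed

text \<open>Cut a shortest factorization of \<open>w @ p\<close> at the boundary. Either the part
  \<open>y1\<close> before the cut is a last block of \<open>w\<close>, or the blocks before it
  already have the block length of \<open>w\<close>, and then any last block satisfies the
  estimate.\<close>

lemma blen_append_last_blocks_ge:
  assumes "w \<noteq> []"
  shows "\<exists>v\<in>last_blocks w. blen E w + blen E (v @ p) \<le> blen E (w @ p) + 1"
proof -
  obtain ys where ys: "concat ys = w @ p" "\<forall>y\<in>set ys. block E y" "length ys = blen E (w @ p)"
    by (rule ex_blocks)
  then have "ys \<noteq> []" using assms by auto
  obtain ys1 y1 y2 ys2 where s: "ys = ys1 @ [y1 @ y2] @ ys2" "concat ys1 @ y1 = w" "y2 @ concat ys2 = p"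
    by (rule concat_eq_append[OF ys(1) \<open>ys \<noteq> []\<close>])
  have b: "block E y1" "block E (y1 @ y2)" "block E y2" using s ys(2) block_prefix block_suffix by fastforce+
  have l1: "blen E (concat ys1) \<le> length ys1" using blen_le[of ys1 E] s ys by auto
  have n: "blen E (w @ p) = length ys1 + 1 + length ys2" using s ys by auto
  have w: "blen E w \<le> blen E (concat ys1) + 1" "blen E (concat ys1) \<le> blen E w"
    using s(2) blen_append_le[of E "concat ys1" y1] blen_append_ge(1)[of E "concat ys1" y1] blen_block[OF b(1)]
    by auto
  show ?thesis
  proof (cases "blen E (concat ys1) + 1 = blen E w")
    case True
    then have "y1 \<in> last_blocks w" using b s unfolding last_blocks_def by auto
    moreover have "blen E (y1 @ p) \<le> 1 + length ys2"
      using blen_le[of "(y1 @ y2) # ys2" E] s ys b by auto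
    ultimately show ?thesis using n l1 True by (intro bexI[of _ y1]) auto
  next
    case False
    obtain v where v: "v \<in> last_blocks w" using last_blocks_nonempty assms by blast
    then have "blen E (v @ p) \<le> 1 + blen E p"
      using blen_append_le[of E v p] blen_block[of E v] unfolding last_blocks_def by auto
    moreover have "blen E p \<le> 1 + length ys2"
      using blen_le[of "y2 # ys2" E] s ys b by auto
    ultimately show ?thesis using v n l1 w False by (intro bexI[of _ v]) auto
  qed
qed

lemma last_blocks_Nil [simp]: "last_blocks [] = {}"
  by (auto simp: last_blocks_def)

text \<open>The growth from \<open>w\<close> to \<open>w @ p\<close> is one less than the least
  block length of \<open>v @ p\<close> over the last blocks \<open>v\<close>, so it depends on
  \<open>w\<close> only through them.\<close>

lemma blen_append_determined:
  assumes "last_blocks w = last_blocks w'"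
  shows "blen E (w @ p) + blen E w' = blen E (w' @ p) + blen E w"
proof (cases "w = [] \<or> w' = []")
  case True
  then have "w = []" "w' = []" using assms last_blocks_nonempty by force+
  then show ?thesis by simp
next
  case False
  have le: "blen E (w2 @ p) + blen E w1 \<le> blen E (w1 @ p) + blen E w2"
    if "w1 \<noteq> []" "last_blocks w1 = last_blocks w2" for w1 w2
  proof -
    obtain v where v: "v \<in> last_blocks w1" "blen E w1 + blen E (v @ p) \<le> blen E (w1 @ p) + 1"
      using blen_append_last_blocks_ge[of w1 p] \<open>w1 \<noteq> []\<close> by blast
    then show ?thesis using blen_append_last_blocks_le[of v w2 p] that(2) by simp
  qed
  show ?thesis using le[of w w'] le[of w' w] False assms by simp
qed

end

section \<open>The automatic structure\<close>

locale automatic_presentation = small_overlap7 +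
  fixes X
  assumes fp: "finite_presentation X E"
begin

abbreviation "S \<equiv> presented_monoid X E"

section \<open>Derivations and the congruence on words over \<open>X\<close>\<close>

lemma rel_lists: "rel E U V \<Longrightarrow> U \<in> lists X"
  using fp unfolding rel_def finite_presentation_def by auto

lemma cong_lists: "u \<approx> v \<Longrightarrow> u \<in> lists X \<longleftrightarrow> v \<in> lists X"
proof -
  have "eqn E n u v \<Longrightarrow> u \<in> lists X \<longleftrightarrow> v \<in> lists X" for n
  proof (induction rule: eqn.induct)
    case (step U V n a b u)
    then show ?case using rel_lists[of U V] rel_lists[OF rel_sym, of U V]
      by (simp only: append_in_lists_conv)
  qed simp
  then show "u \<approx> v \<Longrightarrow> u \<in> lists X \<longleftrightarrow> v \<in> lists X" unfolding cong_def by blast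
qed

text \<open>\<open>cong\<close> ranges over all words of the type, but a derivation that starts over
  \<open>X\<close> stays over \<open>X\<close>.\<close>

lemma pres_cong_iff: "(u, v) \<in> pres_cong X E \<longleftrightarrow> u \<in> lists X \<and> u \<approx> v"
proof
  assume uv: "(u, v) \<in> pres_cong X E"
  then have "u \<in> lists X" using equiv_pres_cong[OF fp] by (meson equiv_class_eq_iff)
  moreover from uv have "u \<approx> v"
    by induction (auto simp: rel_def intro: cong_rel cong_sym cong_trans cong_append)
  ultimately show "u \<in> lists X \<and> u \<approx> v" by simp
next
  have "eqn E n u v \<Longrightarrow> u \<in> lists X \<Longrightarrow> (u, v) \<in> pres_cong X E" for n
  proof (induction rule: eqn.induct)
    case (step U V n a b u)
    then have UV: "(U, V) \<in> pres_cong X E"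
      unfolding rel_def by (auto intro: pres_cong.base pres_cong.sym)
    have ab: "a \<in> lists X" "b \<in> lists X" using step.prems by auto
    have "(a @ U @ b, a @ V @ b) \<in> pres_cong X E"
      using ab UV by (intro pres_cong.append pres_cong.refl)
    moreover have "(a @ V @ b, u) \<in> pres_cong X E"
      using step ab rel_lists[OF rel_sym] by auto
    ultimately show ?case by (rule pres_cong.trans)
  qed (rule pres_cong.refl)
  then show "u \<in> lists X \<and> u \<approx> v \<Longrightarrow> (u, v) \<in> pres_cong X E" unfolding cong_def by blast
qed

definition cls :: "'a word \<Rightarrow> 'a word set" where
  "cls w = pres_cong X E `` {w}"

lemma cls_eq_iff: "u \<in> lists X \<Longrightarrow> v \<in> lists X \<Longrightarrow> cls u = cls v \<longleftrightarrow> u \<approx> v"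
  unfolding cls_def
  using eq_equiv_class_iff[OF equiv_pres_cong[OF fp], of u v] pres_cong_iff[of u v] by simp

lemma carrier_S: "carrier S = cls ` lists X"
  unfolding presented_monoid_def quotient_def cls_def by (simp add: UNION_singleton_eq_range)

section \<open>Blocks as generators, and the language of geodesics\<close>

definition blocks :: "'a word set" where "blocks = {y \<in> lists X. y \<noteq> [] \<and> block E y}"

definition gens :: "'a word set set" where "gens = cls ` blocks"

text \<open>The two sides of a relation are blocks in the same class, so the block of a generator
  has to be chosen.\<close>

definition representative :: "'a word set \<Rightarrow> 'a word" where
  "representative c = (SOME y. y \<in> blocks \<and> cls y = c)"

definition dec :: "'a word set word \<Rightarrow> 'a word" where
  "dec ys = concat (map representative ys)"

text \<open>Block length is invariant, so these are the shortest words over \<open>gens\<close> for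
  their elements.\<close>

definition geodesics :: "'a word set word set" where
  "geodesics = {ys \<in> lists gens. blen E (dec ys) = length ys}"

lemma finite_short_words: "finite {y \<in> lists X. length y \<le> k}"
proof -
  have "{y \<in> lists X. length y \<le> k} = {y. set y \<subseteq> X \<and> length y \<le> k}" by auto
  moreover have "finite X" using fp by (simp add: finite_presentation_def)
  ultimately show ?thesis using finite_lists_length_le[of X k] by simp
qed

lemma finite_gens: "finite gens"
proof -
  have "blocks \<subseteq> {y \<in> lists X. length y \<le> max_len}" by (auto simp: blocks_def block_length)
  then show ?thesis
    unfolding gens_def by (intro finite_imageI finite_subset[OF _ finite_short_words])
qed

lemma representative: "c \<in> gens \<Longrightarrow> representative c \<in> blocks \<and> cls (representative c) = c"
  unfolding representative_def gens_def by (rule someI_ex) auto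

lemma dec_append [simp]: "dec (ys @ zs) = dec ys @ dec zs"
  by (simp add: dec_def)

lemma dec_lists: "ys \<in> lists gens \<Longrightarrow> dec ys \<in> lists X"
proof (induction ys)
  case (Cons c ys)
  then have "representative c \<in> lists X" using representative[of c] unfolding blocks_def by auto
  then show ?case using Cons by (simp add: dec_def)
qed (simp add: dec_def)

lemma word_value_dec: "ys \<in> lists gens \<Longrightarrow> word_value S ys = cls (dec ys)"
proof (induction ys)
  case Nil
  then show ?case by (simp add: word_value_def dec_def cls_def presented_monoid_def)
next
  case (Cons c ys)
  then have "representative c \<in> lists X" "cls (representative c) = c" "dec ys \<in> lists X"
    using representative[of c] dec_lists[of ys] unfolding blocks_def by auto
  then show ?case
    using Cons presented_monoid_mult[OF fp, of "representative c" "dec ys"]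
    by (simp add: word_value_def dec_def cls_def)
qed

lemma blen_dec_le: "ys \<in> lists gens \<Longrightarrow> blen E (dec ys) \<le> length ys"
proof -
  assume ys: "ys \<in> lists gens"
  have "block E (representative c)" if "c \<in> set ys" for c
    using representative[of c] that ys unfolding blocks_def by auto
  then show ?thesis using blen_le[of "map representative ys" E] by (simp add: dec_def)
qed

lemma geodesics_lists: "geodesics \<subseteq> lists gens"
  by (simp add: geodesics_def)

lemma geodesics_prefix: "a @ p \<in> geodesics \<Longrightarrow> a \<in> geodesics"
  using blen_append_le[of E "dec a" "dec p"] blen_dec_le[of a] blen_dec_le[of p] unfolding geodesics_def by auto

lemma geodesics_suffix_lists: "a @ p \<in> geodesics \<Longrightarrow> p \<in> lists gens"
  unfolding geodesics_def by auto

lemma geodesics_onto: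
  assumes "w \<in> lists X"
  obtains ys where "ys \<in> geodesics" "dec ys \<approx> w"
proof -
  obtain bs where bs: "concat bs = w" "\<forall>y\<in>set bs. block E y" "length bs = blen E w"
    by (rule ex_blocks)
  \<comment> \<open>An empty block could be dropped from a shortest factorization.\<close>
  have "[] \<notin> set bs"
  proof
    assume "[] \<in> set bs"
    then obtain b1 b2 where "bs = b1 @ [] # b2" by (meson split_list)
    then show False using bs blen_le[of "b1 @ b2" E] by auto
  qed
  moreover have "b \<in> lists X" if "b \<in> set bs" for b using that assms bs(1) by auto
  ultimately have blocks: "\<forall>b\<in>set bs. b \<in> blocks" using bs(2) unfolding blocks_def by blast
  then have "dec (map cls bs) \<approx> concat bs"
  proof (induction bs)
    case (Cons b bs)
    then have "representative (cls b) \<in> blocks" "cls (representative (cls b)) = cls b"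
      using representative[of "cls b"] unfolding gens_def by auto
    then have "representative (cls b) \<approx> b" using cls_eq_iff Cons.prems unfolding blocks_def by auto
    then show ?case using Cons cong_append unfolding dec_def by auto
  qed (simp add: dec_def)
  moreover from this have "map cls bs \<in> geodesics"
    using blocks bs blen_cong unfolding geodesics_def gens_def by auto
  ultimately show ?thesis using that bs(1) by blast
qed

lemma word_value_carrier: "ys \<in> lists gens \<Longrightarrow> word_value S ys \<in> carrier S"
  by (simp add: carrier_S word_value_dec dec_lists)

lemma word_value_geodesics: "word_value S ` geodesics = carrier S"
proof
  show "word_value S ` geodesics \<subseteq> carrier S"
    using word_value_carrier unfolding geodesics_def by auto
  show "carrier S \<subseteq> word_value S ` geodesics"
    unfolding carrier_S
  proof (rule image_subsetI)
    fix w assume w: "w \<in> lists X"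
    obtain ys where ys: "ys \<in> geodesics" "dec ys \<approx> w" by (rule geodesics_onto[OF w])
    then have gens: "ys \<in> lists gens" by (simp add: geodesics_def)
    have "cls w = word_value S ys"
      using word_value_dec[OF gens] cls_eq_iff[OF dec_lists[OF gens] w] ys(2) by simp
    then show "cls w \<in> word_value S ` geodesics" using ys(1) by (rule image_eqI)
  qed
qed

lemma generates_gens: "generates S gens"
proof -
  have "word_value S ` lists gens \<subseteq> carrier S"
    by (rule image_subsetI) (rule word_value_carrier)
  moreover have "geodesics \<subseteq> lists gens" by (simp add: geodesics_def)
  then have "carrier S \<subseteq> word_value S ` lists gens"
    unfolding word_value_geodesics[symmetric] by (rule image_mono)
  ultimately have "word_value S ` lists gens = carrier S" by (rule equalityI)
  moreover have "blocks \<subseteq> lists X" by (auto simp: blocks_def)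
  then have "gens \<subseteq> carrier S" unfolding gens_def carrier_S by (rule image_mono)
  ultimately show ?thesis unfolding generates_def by (rule conjI[rotated])
qed

lemma finite_last_blocks_dec: "finite ((\<lambda>u. last_blocks (dec u)) ` lists gens)"
proof -
  have "last_blocks (dec u) \<subseteq> {y \<in> lists X. length y \<le> max_len}" if "u \<in> lists gens" for u
    using dec_lists[OF that] block_length unfolding last_blocks_def by auto
  then have "(\<lambda>u. last_blocks (dec u)) ` lists gens \<subseteq> Pow {y \<in> lists X. length y \<le> max_len}" by auto
  then show ?thesis by (rule finite_subset) (simp add: finite_short_words)
qed

lemma geodesics_append_transfer:
  assumes "a @ p \<in> geodesics" "a' \<in> geodesics" "last_blocks (dec a) = last_blocks (dec a')"
  shows "a' @ p \<in> geodesics"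
  using blen_append_determined[OF assms(3), of "dec p"] assms geodesics_prefix[OF assms(1)] unfolding geodesics_def by auto

text \<open>The last blocks, of which there are finitely many sets, decide the residual of a
  geodesic; other words have empty residual, since geodesics are closed under prefixes.\<close>

lemma regular_geodesics: "regular_language gens geodesics"
proof (rule regular_language_residuals)
  show "finite gens" by (rule finite_gens)
  show "geodesics \<subseteq> lists gens" by (rule geodesics_lists)
  have "finite (residual gens geodesics ` geodesics)"
  proof (rule finite_image_factor)
    show "finite ((\<lambda>u. last_blocks (dec u)) ` geodesics)"
      by (rule finite_subset[OF image_mono[OF geodesics_lists] finite_last_blocks_dec])
    show "residual gens geodesics u = residual gens geodesics u'"
      if "u \<in> geodesics" "u' \<in> geodesics" "last_blocks (dec u) = last_blocks (dec u')" for u u'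
      using geodesics_append_transfer[OF _ that(2,3)] geodesics_append_transfer[OF _ that(1) that(3)[symmetric]]
      unfolding residual_def by auto
  qed
  moreover have "residual gens geodesics u = {}" if "u \<notin> geodesics" for u
    using geodesics_prefix that by (auto simp: residual_def)
  then have "residual gens geodesics ` lists gens \<subseteq> insert {} (residual gens geodesics ` geodesics)" by auto
  ultimately show "finite (residual gens geodesics ` lists gens)" by (meson finite.insertI finite_subset)
qed

section \<open>The languages of multiplication by a generator or by the identity\<close>

context
  fixes x :: "'a word set word"
  assumes x: "x \<in> lists gens" "length x \<le> 1"
begin

definition mult_pairs :: "('a word set option \<times> 'a word set option) word set" where
  "mult_pairs = {padded_pair w u |w u. w \<in> geodesics \<and> u \<in> geodesics \<and> dec w @ dec x \<approx> dec u}"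

text \<open>For \<open>a\<close> and \<open>b\<close> of equal length this is meant as the residual
  of \<open>mult_pairs\<close> after \<open>padded_pair a b\<close>.\<close>

definition continuations :: "'a word set word \<Rightarrow> 'a word set word \<Rightarrow> ('a word set option \<times> 'a word set option) word set" where
  "continuations a b = {padded_pair p q |p q. a @ p \<in> geodesics \<and> b @ q \<in> geodesics \<and> dec a @ dec p @ dec x \<approx> dec b @ dec q}"

text \<open>The block bound 3 is the excess 2 in \<open>common_multiple\<close> plus one for the
  block cut at the end of \<open>a\<close> or \<open>b\<close>.\<close>

definition short_multiples :: "'a word \<Rightarrow> 'a word \<Rightarrow> ('a word \<times> 'a word) set" where
  "short_multiples a b = {(p, q). p \<in> lists X \<and> length p \<le> max_len * 3 \<and> q \<in> lists X \<and> length q \<le> max_len * 3 \<and> a @ p \<approx> b @ q}"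

text \<open>By \<open>common_multiple\<close>, a congruence of continuations is a short common
  multiple followed by a common factor \<open>r\<close>. The multiple carries over to
  \<open>a'\<close> and \<open>b'\<close>, \<open>r\<close> is appended again, and the last blocks
  keep the words geodesic.\<close>

lemma continuations_subset:
  assumes ab: "a \<in> geodesics" "b \<in> geodesics" "length a = length b" and ab': "a' \<in> geodesics" "b' \<in> geodesics"
    and la: "last_blocks (dec a) = last_blocks (dec a')" and lb: "last_blocks (dec b) = last_blocks (dec b')"
    and sm: "short_multiples (dec a) (dec b) \<subseteq> short_multiples (dec a') (dec b')"
  shows "continuations a b \<subseteq> continuations a' b'"
proof
  fix z assume "z \<in> continuations a b"
  then obtain p q where z: "z = padded_pair p q" "a @ p \<in> geodesics" "b @ q \<in> geodesics"
      "dec a @ (dec p @ dec x) \<approx> dec b @ dec q"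
    unfolding continuations_def by auto
  obtain p0 q0 r where c: "dec a @ p0 \<approx> dec b @ q0" "dec p @ dec x \<approx> p0 @ r" "dec q \<approx> q0 @ r"
      "blen E (dec a @ p0) \<le> blen E (dec a) + 2 \<or> blen E (dec a @ p0) \<le> blen E (dec b) + 2"
    by (rule common_multiple[OF z(4)])
  have bl: "blen E (dec a) = blen E (dec b)" using ab unfolding geodesics_def by simp
  have "dec p @ dec x \<in> lists X" "dec q \<in> lists X"
    using dec_lists[OF geodesics_suffix_lists] z x(1) dec_lists[of x] by auto
  then have X: "p0 \<in> lists X" "q0 \<in> lists X" using cong_lists[OF c(2)] cong_lists[OF c(3)] by auto
  have "blen E p0 \<le> 3" "blen E q0 \<le> 3"
    using c(4) bl blen_cong[OF c(1)] blen_append_ge(3)[of E "dec a" p0] blen_append_ge(3)[of E "dec b" q0]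
    by auto
  then have "length p0 \<le> max_len * 3" "length q0 \<le> max_len * 3"
    using length_le[of p0] length_le[of q0] by (meson mult_le_mono2 order_trans)+
  then have "(p0, q0) \<in> short_multiples (dec a) (dec b)"
    using c(1) X unfolding short_multiples_def by simp
  then have "dec a' @ p0 \<approx> dec b' @ q0" using sm unfolding short_multiples_def by auto
  then have "(dec a' @ p0) @ r \<approx> (dec b' @ q0) @ r" using cong_append by blast
  moreover have "dec a' @ dec p @ dec x \<approx> dec a' @ p0 @ r" "dec b' @ dec q \<approx> dec b' @ q0 @ r"
    using c cong_append by blast+
  ultimately have "dec a' @ dec p @ dec x \<approx> dec b' @ dec q"
    using cong_trans cong_sym by (metis append_assoc)
  then show "z \<in> continuations a' b'"
    using z geodesics_append_transfer ab' la lb unfolding continuations_def by blast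
qed

lemma finite_continuations: "finite ((\<lambda>(a, b). continuations a b) ` {(a, b). a \<in> geodesics \<and> b \<in> geodesics \<and> length a = length b})"
proof (rule finite_image_factor)
  let ?P = "{(a, b). a \<in> geodesics \<and> b \<in> geodesics \<and> length a = length b}"
  let ?T = "(\<lambda>u. last_blocks (dec u)) ` lists gens"
  let ?W = "{y \<in> lists X. length y \<le> max_len * 3}"
  let ?h = "\<lambda>(a, b). (last_blocks (dec a), last_blocks (dec b), short_multiples (dec a) (dec b))"
  have "?h ` ?P \<subseteq> ?T \<times> ?T \<times> Pow (?W \<times> ?W)"
    by (auto simp: geodesics_def short_multiples_def)
  then show "finite (?h ` ?P)"
    by (rule finite_subset) (intro finite_cartesian_product finite_last_blocks_dec finite_Pow_iff[THEN iffD2] finite_short_words)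
  fix s t assume st: "s \<in> ?P" "t \<in> ?P" "?h s = ?h t"
  then obtain a b a' b' where "s = (a, b)" "t = (a', b')" by (metis surj_pair)
  then show "(\<lambda>(a, b). continuations a b) s = (\<lambda>(a, b). continuations a b) t"
    using continuations_subset[of a b a' b'] continuations_subset[of a' b' a b] st by auto
qed

text \<open>Appending at most one block never lowers the block length and raises it by at most
  one.\<close>

lemma length_cases:
  assumes "w \<in> geodesics" "u \<in> geodesics" "dec w @ dec x \<approx> dec u"
  shows "length u = length w \<or> length u = length w + 1"
proof -
  have "blen E (dec x) \<le> 1" using blen_dec_le[OF x(1)] x(2) by simp
  then show ?thesis
    using blen_cong[OF assms(3)] blen_append_le[of E "dec w" "dec x"] blen_append_ge(1)[of E "dec w" "dec x"]
      assms unfolding geodesics_def by auto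
qed

lemma residual_mult_pairs_cases:
  assumes "residual (padded_alphabet gens) mult_pairs u \<noteq> {}"
  shows "residual (padded_alphabet gens) mult_pairs u = {[]} \<or>
    (\<exists>a b. a \<in> geodesics \<and> b \<in> geodesics \<and> length a = length b \<and> residual (padded_alphabet gens) mult_pairs u = continuations a b)"
proof -
  obtain z0 w v where 0: "u @ z0 = padded_pair w v" "w \<in> geodesics" "v \<in> geodesics" "dec w @ dec x \<approx> dec v"
      "z0 \<in> lists (padded_alphabet gens)"
  proof -
    obtain z0 where "z0 \<in> residual (padded_alphabet gens) mult_pairs u" using assms by blast
    then show ?thesis using that unfolding residual_def mult_pairs_def by auto
  qed
  have len: "length v = length w \<or> length v = length w + 1" using length_cases 0 by blast
  show ?thesis
  proof (cases "length u \<le> length w")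
    case True
    \<comment> \<open>\<open>v\<close> is no shorter than \<open>w\<close>, so here \<open>u\<close>
      is a padded pair of prefixes of equal length.\<close>
    define a b where "a = take (length u) w" and "b = take (length u) v"
    have l: "length a = length b" "length a = length u" using True len by (auto simp: a_def b_def)
    have wv: "w = a @ drop (length u) w" "v = b @ drop (length u) v" by (simp_all add: a_def b_def)
    have "u @ z0 = padded_pair a b @ padded_pair (drop (length u) w) (drop (length u) v)"
      using 0(1) wv padded_pair_append[OF l(1), of "drop (length u) w" "drop (length u) v"] by simp
    moreover have "length u = length (padded_pair a b)" using l by (simp only: length_padded_pair max.idem)
    ultimately have u: "u = padded_pair a b" by (metis append_eq_append_conv)
    have "z \<in> residual (padded_alphabet gens) mult_pairs u \<longleftrightarrow> z \<in> continuations a b" for z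
    proof
      assume "z \<in> residual (padded_alphabet gens) mult_pairs u"
      then obtain w' v' where z: "u @ z = padded_pair w' v'" "w' \<in> geodesics" "v' \<in> geodesics" "dec w' @ dec x \<approx> dec v'"
        unfolding residual_def mult_pairs_def by auto
      have e: "w' = a @ fsts z" "v' = b @ snds z"
        using arg_cong[OF z(1), of fsts] arg_cong[OF z(1), of snds] u by simp_all
      then have "u @ z = padded_pair a b @ padded_pair (fsts z) (snds z)"
        using z(1) padded_pair_append[OF l(1)] by simp
      then have "z = padded_pair (fsts z) (snds z)" using u by simp
      then show "z \<in> continuations a b" using z(2-4) e unfolding continuations_def by auto
    next
      assume "z \<in> continuations a b"
      then obtain p q where z: "z = padded_pair p q" "a @ p \<in> geodesics" "b @ q \<in> geodesics"
          "dec a @ dec p @ dec x \<approx> dec b @ dec q"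
        unfolding continuations_def by auto
      then have "u @ z = padded_pair (a @ p) (b @ q)" using u padded_pair_append[OF l(1)] by simp
      moreover have KI: "padded_pair (a @ p) (b @ q) \<in> mult_pairs"
        unfolding mult_pairs_def using z(2-4) by (intro CollectI exI[of _ "a @ p"] exI[of _ "b @ q"]) simp
      moreover have "z \<in> lists (padded_alphabet gens)"
        using padded_pair_lists[OF geodesics_suffix_lists[OF z(2)] geodesics_suffix_lists[OF z(3)]] z(1) by simp
      ultimately show "z \<in> residual (padded_alphabet gens) mult_pairs u"
        using KI by (simp add: residual_def)
    qed
    moreover have "a \<in> geodesics" "b \<in> geodesics"
      using geodesics_prefix[of a "drop (length u) w"] geodesics_prefix[of b "drop (length u) v"] 0(2,3) wv by simp_all
    ultimately show ?thesis using l by blast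
  next
    case False
    have "length u + length z0 = max (length w) (length v)"
      using arg_cong[OF 0(1), of length] by (simp only: length_append length_padded_pair)
    \<comment> \<open>\<open>u\<close> is longer than \<open>w\<close>, so it is the whole pair and
      ends in its only padded letter.\<close>
    then have lv: "length v = length w + 1" and "length z0 = 0" using False len by linarith+
    then have z0: "z0 = []" by simp
    from lv obtain v0 c where v: "v = v0 @ [c]" "length v0 = length w" by (cases v rule: rev_cases) auto
    have "padded_pair [] [c] = [(None, Some c)]" by (simp add: padded_pair_def pad_right_def)
    then have u: "u = padded_pair w v0 @ [(None, Some c)]"
      using 0(1) z0 v padded_pair_append[of w v0 "[]" "[c]"] by simp
    have "z = []" if zr: "z \<in> residual (padded_alphabet gens) mult_pairs u" for z
    proof -
      obtain w' v' where z: "u @ z = padded_pair w' v'" "w' \<in> geodesics" "v' \<in> geodesics" "dec w' @ dec x \<approx> dec v'"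
        using zr unfolding residual_def mult_pairs_def by auto
      have "fsts ((None, Some c) # z) = fsts z" "snds ((None, Some c) # z) = c # snds z"
        by (simp_all add: fsts_def snds_def)
      then have e: "w' = w @ fsts z" "v' = v0 @ ([c] @ snds z)"
        using arg_cong[OF z(1), of fsts] arg_cong[OF z(1), of snds] u by simp_all
      have "u @ z = padded_pair w v0 @ padded_pair (fsts z) ([c] @ snds z)"
        using z(1) e padded_pair_append[of w v0 "fsts z" "[c] @ snds z"] v(2) by simp
      then have p: "(None, Some c) # z = padded_pair (fsts z) ([c] @ snds z)" using u by simp
      \<comment> \<open>After padding has begun in the first component, no letter can follow
        there.\<close>
      have "fsts z = []"
      proof (cases "fsts z")
        case (Cons d ds)
        then show ?thesis using p by (simp add: padded_pair_def pad_right_def Let_def)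
      qed
      then have "snds z = []" using length_cases[OF z(2-4)] e v(2) by auto
      then show ?thesis using arg_cong[OF p, of length] \<open>fsts z = []\<close> by simp
    qed
    then show ?thesis using assms by blast
  qed
qed

lemma regular_mult_pairs: "regular_language (padded_alphabet gens) mult_pairs"
proof (rule regular_language_residuals)
  show "finite (padded_alphabet gens)" using finite_gens by (simp add: padded_alphabet_def)
  show "mult_pairs \<subseteq> lists (padded_alphabet gens)"
  proof
    fix z assume "z \<in> mult_pairs"
    then obtain w u where "z = padded_pair w u" "w \<in> geodesics" "u \<in> geodesics" unfolding mult_pairs_def by auto
    then show "z \<in> lists (padded_alphabet gens)"
      using padded_pair_lists[OF subsetD[OF geodesics_lists] subsetD[OF geodesics_lists]] by simp
  qed
  have "residual (padded_alphabet gens) mult_pairs ` lists (padded_alphabet gens) \<subseteq>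
    {{}, {[]}} \<union> (\<lambda>(a, b). continuations a b) ` {(a, b). a \<in> geodesics \<and> b \<in> geodesics \<and> length a = length b}"
  proof (rule image_subsetI)
    fix u
    show "residual (padded_alphabet gens) mult_pairs u \<in>
      {{}, {[]}} \<union> (\<lambda>(a, b). continuations a b) ` {(a, b). a \<in> geodesics \<and> b \<in> geodesics \<and> length a = length b}"
    proof (cases "residual (padded_alphabet gens) mult_pairs u = {}")
      case False
      from residual_mult_pairs_cases[OF this] show ?thesis
      proof (elim disjE exE conjE)
        fix a b assume "a \<in> geodesics" "b \<in> geodesics" "length a = length b" "residual (padded_alphabet gens) mult_pairs u = continuations a b"
        then show ?thesis by (intro UnI2 image_eqI[of _ _ "(a, b)"]) simp_all
      qed simp
    qed simp
  qed
  then show "finite (residual (padded_alphabet gens) mult_pairs ` lists (padded_alphabet gens))"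
    by (rule finite_subset) (use finite_continuations in simp)
qed

end

theorem automatic_S: "automatic S"
proof -
  have "regular_language (padded_alphabet gens)
      {padded_pair w u |w u. w \<in> geodesics \<and> u \<in> geodesics \<and> word_value S (w @ x) = word_value S u}"
    if "x \<in> insert [] ((\<lambda>a. [a]) ` gens)" for x
  proof -
    have x: "x \<in> lists gens" "length x \<le> 1" using that by auto
    have "word_value S (w @ x) = word_value S u \<longleftrightarrow> dec w @ dec x \<approx> dec u" if "w \<in> geodesics" "u \<in> geodesics" for w u
    proof -
      have "w @ x \<in> lists gens" "u \<in> lists gens" using that x(1) by (simp_all add: geodesics_def)
      then show ?thesis using word_value_dec cls_eq_iff dec_lists by (metis dec_append)
    qed
    then have "{padded_pair w u |w u. w \<in> geodesics \<and> u \<in> geodesics \<and> word_value S (w @ x) = word_value S u} = mult_pairs x"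
      unfolding mult_pairs_def[OF x] by (intro Collect_cong ex_cong1) auto
    then show ?thesis using regular_mult_pairs[OF x] by simp
  qed
  then have "automatic_structure S gens geodesics"
    unfolding automatic_structure_def using regular_geodesics word_value_geodesics by simp
  then show ?thesis
    unfolding automatic_def using monoid_presented_monoid[OF fp] finite_gens generates_gens by blast
qed

end

section \<open>From piece-lengths to the assumptions of the locales\<close>

lemma piece_length_le: "\<forall>P\<in>set Ps. piece E P \<Longrightarrow> piece_length E (concat Ps) \<le> enat (length Ps)"
  unfolding piece_length_def by (rule Inf_lower) blast

theorem theorem1:
  fixes X :: "'a set" and E :: "('a word \<times> 'a word) set"
  assumes "finite_presentation X E"
    and "K32 E"
    and "\<forall>(L, R)\<in>E. piece_length E L + piece_length E R \<ge> 7"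
  shows "automatic (presented_monoid X E)"
proof -
  have ne: "U \<noteq> [] \<and> V \<noteq> []" if "rel E U V" for U V
    using that assms(1) unfolding rel_def finite_presentation_def by auto
  have hl: "hd U \<noteq> hd V \<and> last U \<noteq> last V" if "rel E U V" for U V
  proof -
    have "\<forall>p\<in>E. hd (fst p) \<noteq> hd (snd p) \<and> last (fst p) \<noteq> last (snd p)"
      using assms(2) unfolding K32_def case_prod_beta by (elim conjE)
    from this[THEN bspec, of "(U, V)"] this[THEN bspec, of "(V, U)"] show ?thesis
      using that unfolding rel_def by auto
  qed
  have dist: "\<forall>p\<in>E. \<forall>q\<in>E. p \<noteq> q \<longrightarrow> distinct [snd p, fst p, snd q, fst q]"
    using assms(2) unfolding K32_def case_prod_beta prod.collapse by (elim conjE)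
  have uniq: "V = V'" if "rel E U V" "rel E U V'" for U V V'
  proof (rule ccontr)
    assume "V \<noteq> V'"
    moreover have "U \<noteq> V" "U \<noteq> V'" using hl that by blast+
    \<comment> \<open>Each relation may hold in either orientation. In all four combinations the two
      pairs differ, yet share the word \<open>U\<close>.\<close>
    ultimately show False
      using that dist[THEN bspec, THEN bspec, of "(U, V)" "(U, V')"]
        dist[THEN bspec, THEN bspec, of "(U, V)" "(V', U)"]
        dist[THEN bspec, THEN bspec, of "(V, U)" "(U, V')"]
        dist[THEN bspec, THEN bspec, of "(V, U)" "(V', U)"]
      unfolding rel_def by auto
  qed
  have two: "W \<noteq> P @ Q" if "W \<in> defining_words E" "piece E P" "piece E Q" for W P Q
  proof
    assume "W = P @ Q"
    then have "piece_length E W \<le> enat 2"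
      using piece_length_le[of "[P, Q]" E] that by (simp add: numeral_2_eq_2)
    moreover have "3 \<le> piece_length E W" using that(1) assms(2) unfolding K32_def by blast
    ultimately have "3 \<le> enat 2" by (rule order_trans[rotated])
    then show False by (simp add: numeral_eq_enat)
  qed
  have three: "piece_length E W \<le> 3" if tp: "three_pieces E W" for W
  proof -
    obtain P Q R where "piece E P" "piece E Q" "piece E R" "W = P @ Q @ R"
      using tp unfolding three_pieces_def by blast
    then show ?thesis using piece_length_le[of "[P, Q, R]" E] by (simp add: numeral_3_eq_3 numeral_eq_enat)
  qed
  have sev: "\<not> three_pieces E V" if "rel E U V" "three_pieces E U" for U V
  proof
    assume "three_pieces E V"
    then have "piece_length E U + piece_length E V \<le> 3 + 3" using three that(2) add_mono by blast
    moreover have "7 \<le> piece_length E U + piece_length E V"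
      using that(1) assms(3) unfolding rel_def by (auto simp: add.commute)
    ultimately have "(7 :: enat) \<le> 3 + 3" by (rule order_trans[rotated])
    then show False by simp
  qed
  interpret automatic_presentation E X
    by unfold_locales
      (use assms(1) ne hl uniq two sev in \<open>auto simp: finite_presentation_def\<close>)
  show ?thesis by (rule automatic_S)
qed

end
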